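(* Let $\mathbf{A}=[\mathbf{a}_1\ \cdots\ \mathbf{a}_m]\in\mathbb{R}^{n\times m}$ with $m\ge n$ be such that (i) no column of $\mathbf{A}$ is the zero vector and (ii) no two (distinct-index) columns of $\mathbf{A}$ are scalar multiples of each other. Let $Z=Z(\mathbf{A})=\{\mathbf{A}\mathbf{x}\mid \mathbf{x}\in[-1,1]^m\}$. Let $\varepsilon>0$ and $\delta>0$, let $b\ge\operatorname{diam}(Z)$, set $$k=\left(\tfrac12\bigl(1-\sin(\arctan(b/\delta))\bigr)\right)^{\frac{n-1}{2}},$$ and let $p$ be a positive integer with $$p>\frac{\log(|\operatorname{vert}(Z)|/\varepsilon)}{\log(1/(1-k))}.$$ Let $V$ be the (random) subset of $\operatorname{vert}(Z)$ produced by the randomized vertex enumeration algorithm (described in the context) after $p$ iterations. Then $$h(Z,\operatorname{conv}(V))\le\frac{|\operatorname{vert}(Z)\setminus V|}{2}\,\delta$$ with probability at least $1-2^a\,\varepsilon$, where $a=|\operatorname{vert}(Z)\setminus U_Z|/2$ and $$U_Z=\{\mathbf{v}\in\operatorname{vert}(Z)\mid\alpha_Z(\mathbf{v})\ge\delta\}.$$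
   Context: $\operatorname{vert}(Z)$ is the set of vertices (extreme points) of $Z$; $\operatorname{conv}$ is the convex hull; $\operatorname{diam}$ is the (Euclidean) diameter; $h$ is the Hausdorff distance with respect to the Euclidean norm. The simplicial constant of a vertex $\mathbf{v}$ of $Z$ is $\alpha_Z(\mathbf{v})=\inf\{\|\mathbf{v}-\mathbf{x}\|_2\mid\mathbf{x}\in\operatorname{conv}(\operatorname{vert}(Z)\setminus\{\mathbf{v}\})\}$. Randomized vertex enumeration algorithm: start with $V=\varnothing$. In each iteration draw $\mathbf{x}$ independently from the standard Gaussian distribution on $\mathbb{R}^n$, compute $\mathbf{v}_+=\mathbf{A}\operatorname{sign}(\mathbf{A}^T\mathbf{x})$ and $\mathbf{v}_-=-\mathbf{v}_+$ (where $\operatorname{sign}$ acts entrywise with values in $\{-1,1\}$; almost surely $\mathbf{A}^T\mathbf{x}$ has no zero entries), and if $\mathbf{v}_+\notin V$ add $\mathbf{v}_+$ and $\mathbf{v}_-$ to $V$. The algorithm stops early if $V$ already contains all vertices of $Z$. Thus after $p$ iterations, with independent standard Gaussian samples $\mathbf{x}_1,\dots,\mathbf{x}_p$, one has almost surely $V=\{\pm\mathbf{A}\operatorname{sign}(\mathbf{A}^T\mathbf{x}_i)\mid i=1,\dots,p\}$. *)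

theory Defs
  imports "HOL-Probability.Probability"
begin

definition zonotope :: "real ^ 'm ^ 'n \<Rightarrow> (real ^ 'n) set"
  where "zonotope A = {A *v x | x. \<forall>j. - 1 \<le> x $ j \<and> x $ j \<le> 1}"

definition vert :: "'a::real_vector set \<Rightarrow> 'a set"
  where "vert S = {v. v extreme_point_of S}"

(* The infimum is the mathematical one provided S has a vertex other than v. *)
definition simplicial_constant :: "'a::real_normed_vector set \<Rightarrow> 'a \<Rightarrow> real"
  where "simplicial_constant S v = (INF x \<in> convex hull (vert S - {v}). norm (v - x))"

(* Intended for nonempty bounded sets, on which the suprema are over nonempty sets bounded above. *)
definition hausdorff_distance :: "'a::metric_space set \<Rightarrow> 'a set \<Rightarrow> real"
  where "hausdorff_distance S T = max (SUP x \<in> S. infdist x T) (SUP y \<in> T. infdist y S)"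

(* The library sgn sends 0 to 0; here the values are in {-1, 1}. The choice made at 0 only
   matters on a Gaussian null set when the columns of the matrix are nonzero. *)
definition sign_vec :: "real ^ 'm \<Rightarrow> real ^ 'm"
  where "sign_vec y = (\<chi> j. if 0 \<le> y $ j then 1 else - 1)"

definition enum_step :: "real ^ 'm ^ 'n \<Rightarrow> (real ^ 'n) set \<Rightarrow> real ^ 'n \<Rightarrow> (real ^ 'n) set"
  where "enum_step A V x =
    (let v = A *v sign_vec (transpose A *v x)
     in if v \<notin> V then V \<union> {v, - v} else V)"

(* The set V after p iterations on the samples x 0, x 1, ...; once V contains all vertices the
   algorithm has stopped and V no longer changes. *)
primrec vertex_enum :: "real ^ 'm ^ 'n \<Rightarrow> (nat \<Rightarrow> real ^ 'n) \<Rightarrow> nat \<Rightarrow> (real ^ 'n) set"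
  where
    "vertex_enum A x 0 = {}"
  | "vertex_enum A x (Suc p) =
      (let V = vertex_enum A x p
       in if vert (zonotope A) \<subseteq> V then V else enum_step A V (x p))"

definition std_gaussian_density :: "real ^ 'n \<Rightarrow> real"
  where "std_gaussian_density x = (\<Prod>i\<in>UNIV. std_normal_density (x $ i))"

end

theory Submission
  imports Defs "HOL-Real_Asymp.Real_Asymp"
begin

text \<open>
  A vertex $v$ of $Z$ is found as soon as a sample or its negative falls into the normal cone of $v$. If
  $v$ has distance at least $\delta$ from the hull of the other vertices, then, all vertices being within
  $b$ of each other, this normal cone contains a circular cone of opening angle
  $\theta = \frac\pi2 - \arctan(b/\delta)$. The cone and its negative together have Gaussian measure at
  least $\sin(\theta/2)^{n-1} = k$ (\<open>double_cone_gaussian_bound\<close>), so all $p$ samples miss them with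
  probability at most $(1-k)^p \le \varepsilon / |\operatorname{vert}(Z)|$.

  Vertices that are not well separated in this sense may well be missed, and the bound on the
  Hausdorff distance has to charge $\delta$ for each missing pair $\pm v$. Deleting such pairs one after the
  other works as long as the next missing vertex lies within $\delta$ of what remains
  (\<open>hausdorff_distance_missing_vertices\<close>). The process gets stuck only at a symmetric set $S$ of
  deleted vertices and a missing $v$ that is well separated from the vertices outside $S$. But then
  the normal cone of $v$ in the polytope spanned by the vertices outside $S$ contains the circular
  cone, and every sample in that normal cone finds $v$ or a vertex of $S$ (\<open>sign_vertex_hit\<close>), although
  all of these are missing. So each stuck pair $(S, v)$ again has probability at most
  $\varepsilon / |\operatorname{vert}(Z)|$.

  Separation only grows when points are deleted, so $S$ avoids $U_Z$. This leaves at most $2^a$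
  symmetric sets $S$ and at most $|\operatorname{vert}(Z)|$ vertices $v$, and the union bound gives
  $2^a \varepsilon$.
\<close>

section \<open>Lebesgue measure under isometries and the law of the norm\<close>

text \<open>
  The image measure $\mu$ of Lebesgue measure $\lambda$ is again translation invariant, and it agrees
  with $\lambda$ on the unit ball $B$, which the isometry preserves. Uniqueness of such a measure is
  obtained by computing $\int\int 1_E(x)\, 1_B(y - x)\, d\lambda(y)\, d\mu(x)$ in both orders: one gives
  $\mu(E)\lambda(B)$, the other $\lambda(E)\mu(B)$.
\<close>
lemma lborel_distr_linear_isometry:
  fixes f :: "'a::euclidean_space \<Rightarrow> 'a"
  assumes lin: "linear f" and iso: "\<And>x. norm (f x) = norm x"
  shows "distr lborel borel f = lborel"
proof -
  let ?\<mu> = "distr lborel borel f"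
  let ?B = "ball 0 1 :: 'a set"
  have [measurable]: "f \<in> borel_measurable borel"
    using lin by (simp add: borel_measurable_continuous_onI linear_continuous_on linear_linear)
  have B_sets [measurable]: "?B \<in> sets borel" by simp
  have mu_B: "emeasure ?\<mu> ?B = emeasure lborel ?B"
    by (subst emeasure_distr) (auto simp: vimage_def iso ball_def intro!: arg_cong[where f="emeasure lborel"])
  have "inj f"
    using lin iso by (metis linear_injective_0 norm_eq_zero)
  then have surj: "surj f"
    using lin linear_injective_imp_surjective by blast
  have transl_lborel: "(\<integral>\<^sup>+x. g (c + x) \<partial>lborel) = (\<integral>\<^sup>+x. g x \<partial>lborel)"
    if [measurable]: "g \<in> borel_measurable borel" for g :: "'a \<Rightarrow> ennreal" and c
    by (subst (2) lborel_affine[of 1 c]) (auto simp: nn_integral_distr density_1)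
  have transl: "(\<integral>\<^sup>+x. g (c + x) \<partial>?\<mu>) = (\<integral>\<^sup>+x. g x \<partial>?\<mu>)"
    if [measurable]: "g \<in> borel_measurable borel" for g :: "'a \<Rightarrow> ennreal" and c
  proof -
    obtain d where d: "c = f d" using surj by auto
    show ?thesis
      using transl_lborel[of "\<lambda>x. g (f x)" d]
      by (simp add: nn_integral_distr d linear_add[OF lin])
  qed
  have sf: "sigma_finite_measure ?\<mu>"
  proof
    have "emeasure ?\<mu> (ball 0 r) = emeasure lborel (ball (0::'a) r)" for r
      by (subst emeasure_distr) (auto simp: vimage_def iso ball_def intro!: arg_cong[where f="emeasure lborel"])
    then have "emeasure ?\<mu> (ball 0 r) \<noteq> \<infinity>" for r
      using emeasure_bounded_finite[of "ball (0::'a) r"] by (simp add: top.not_eq_extremum)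
    then show "\<exists>A. countable A \<and> A \<subseteq> sets ?\<mu> \<and> \<Union> A = space ?\<mu> \<and> (\<forall>a\<in>A. emeasure ?\<mu> a \<noteq> \<infinity>)"
      by (intro exI[of _ "range (\<lambda>n::nat. ball 0 (real n))"]) (auto intro: reals_Archimedean2)
  qed
  interpret P: pair_sigma_finite ?\<mu> "lborel :: 'a measure"
    using sf by (intro pair_sigma_finite.intro sigma_finite_lborel)
  show ?thesis
  proof (rule measure_eqI)
    fix E assume "E \<in> sets ?\<mu>"
    then have [measurable]: "E \<in> sets borel" by simp
    have B_shift: "(\<integral>\<^sup>+y. indicator ?B (y - x) \<partial>lborel) = emeasure lborel ?B" for x :: 'a
    proof -
      have "(\<integral>\<^sup>+y. indicator ?B (- x + y) \<partial>lborel) = (\<integral>\<^sup>+y. indicator ?B y \<partial>lborel)"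
        by (rule transl_lborel) (rule borel_measurable_indicator[OF B_sets])
      then show ?thesis by simp
    qed
    have "emeasure ?\<mu> E * emeasure lborel ?B = (\<integral>\<^sup>+x. indicator E x * emeasure lborel ?B \<partial>?\<mu>)"
      by (subst nn_integral_multc) auto
    also have "\<dots> = (\<integral>\<^sup>+x. \<integral>\<^sup>+y. indicator E x * indicator ?B (y - x) \<partial>lborel \<partial>?\<mu>)"
      by (simp add: B_shift nn_integral_cmult)
    also have "\<dots> = (\<integral>\<^sup>+y. \<integral>\<^sup>+x. indicator E x * indicator ?B (y - x) \<partial>?\<mu> \<partial>lborel)"
      by (rule P.Fubini'[symmetric]) measurable
    also have "\<dots> = (\<integral>\<^sup>+y. \<integral>\<^sup>+x. indicator E (y + x) * indicator ?B (- x) \<partial>?\<mu> \<partial>lborel)"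
    proof (rule nn_integral_cong)
      fix y :: 'a
      have "(\<integral>\<^sup>+x. indicator E (y + x) * indicator ?B (y - (y + x)) \<partial>?\<mu>) = (\<integral>\<^sup>+x. indicator E x * indicator ?B (y - x) \<partial>?\<mu>)"
        by (rule transl) measurable
      then show "(\<integral>\<^sup>+x. indicator E x * indicator ?B (y - x) \<partial>?\<mu>) = (\<integral>\<^sup>+x. indicator E (y + x) * indicator ?B (- x) \<partial>?\<mu>)"
        by simp
    qed
    also have "\<dots> = (\<integral>\<^sup>+x. \<integral>\<^sup>+y. indicator E (y + x) * indicator ?B (- x) \<partial>lborel \<partial>?\<mu>)"
      by (rule P.Fubini') measurable
    also have "\<dots> = (\<integral>\<^sup>+x. emeasure lborel E * indicator ?B x \<partial>?\<mu>)"
    proof (rule nn_integral_cong)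
      fix x :: 'a
      have "(\<integral>\<^sup>+y. indicator E (x + y) \<partial>lborel) = (\<integral>\<^sup>+y. indicator E y \<partial>lborel)"
        by (rule transl_lborel) measurable
      then have "(\<integral>\<^sup>+y. indicator E (y + x) \<partial>lborel) = emeasure lborel E"
        by (simp add: add.commute)
      then show "(\<integral>\<^sup>+y. indicator E (y + x) * indicator ?B (- x) \<partial>lborel) = emeasure lborel E * indicator ?B x"
        by (subst nn_integral_multc) (auto simp: indicator_def)
    qed
    also have "\<dots> = emeasure lborel E * emeasure lborel ?B"
      by (subst nn_integral_cmult) (auto simp: mu_B)
    finally have eq: "emeasure ?\<mu> E * emeasure lborel ?B = emeasure lborel E * emeasure lborel ?B" .
    have "emeasure lborel ?B \<noteq> 0"
      using unit_ball_vol_pos[of "real DIM('a)"] by (simp add: emeasure_ball del: unit_ball_vol_pos)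
    moreover have "emeasure lborel ?B \<noteq> \<infinity>"
      using emeasure_bounded_finite[of ?B] by (simp add: top.not_eq_extremum)
    ultimately show "emeasure ?\<mu> E = emeasure lborel E"
      using eq by (simp add: mult.commute[of _ "emeasure lborel ?B"] ennreal_mult_cancel_left)
  qed simp
qed

text \<open>
  Polar coordinates for functions of the norm only: the volume $V r^m$ of a ball determines the law
  of the norm, so its density is $V m r^{m-1}$.
\<close>
lemma radial_distr_lborel:
  fixes I :: "'i set"
  assumes I: "finite I" "I \<noteq> {}"
  defines "m \<equiv> card I"
  shows "distr (\<Pi>\<^sub>M i\<in>I. lborel) borel (\<lambda>f. sqrt (\<Sum>i\<in>I. (f i)\<^sup>2)) =
    density lborel (\<lambda>r. ennreal (unit_ball_vol m * m * r ^ (m - 1)) * indicator {0..} r)"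
    (is "distr ?P borel ?n = density lborel ?d")
proof (rule measure_eqI_generator_eq[where \<Omega>=UNIV and E="range atMost" and A="\<lambda>n. {..real n}"])
  have m: "m > 0" using I by (simp add: m_def card_gt_0_iff)
  let ?V = "unit_ball_vol (real m)"
  have D: "emeasure (distr ?P borel ?n) {..r} = emeasure ?P ({f. ?n f \<le> r} \<inter> space ?P)" for r
    by (subst emeasure_distr) (auto intro!: arg_cong[where f="emeasure ?P"])
  have pos: "emeasure (distr ?P borel ?n) {..r} = ennreal (?V * r ^ m)" if "r > 0" for r
    unfolding D m_def by (rule emeasure_cball_aux) (use I that in auto)
  have eq: "emeasure (distr ?P borel ?n) {..r} = emeasure (density lborel ?d) {..r}" for r
  proof -
    have zero: "emeasure (distr ?P borel ?n) {..0} = 0"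
    proof -
      have "(\<lambda>k. ennreal (?V * (1 / real (Suc k)) ^ m)) \<longlonglongrightarrow> ennreal (?V * 0 ^ m)"
        by (intro tendsto_intros lim_1_over_n LIMSEQ_Suc[of "\<lambda>n. 1 / real n"])
      then have "emeasure (distr ?P borel ?n) {..0} \<le> ennreal (?V * 0 ^ m)"
      proof (rule LIMSEQ_le_const, intro exI allI impI)
        fix k :: nat
        have "emeasure (distr ?P borel ?n) {..0} \<le> emeasure (distr ?P borel ?n) {..1 / real (Suc k)}"
          by (intro emeasure_mono) auto
        then show "emeasure (distr ?P borel ?n) {..0} \<le> ennreal (?V * (1 / real (Suc k)) ^ m)"
          by (subst (asm) pos) auto
      qed
      then show ?thesis using m by (simp add: power_0_left)
    qed
    have neg: "emeasure (distr ?P borel ?n) {..r} = 0" if "r \<le> 0"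
    proof -
      have "emeasure (distr ?P borel ?n) {..r} \<le> emeasure (distr ?P borel ?n) {..0}"
        using that by (intro emeasure_mono) auto
      then show ?thesis using zero by simp
    qed
    have dens: "emeasure (density lborel ?d) {..r} =
        (\<integral>\<^sup>+x. ennreal (?V * m * x ^ (m - 1)) * indicator {0..r} x \<partial>lborel)"
      by (subst emeasure_density) (auto intro!: nn_integral_cong simp: indicator_def)
    show ?thesis
    proof (cases "r > 0")
      case True
      have "(\<integral>\<^sup>+x. ennreal (?V * m * x ^ (m - 1)) * indicator {0..r} x \<partial>lborel) = ennreal (?V * r ^ m - ?V * 0 ^ m)"
        using True by (intro nn_integral_FTC_Icc) (auto intro!: derivative_eq_intros simp: mult_ac)
      then show ?thesis using m unfolding pos[OF True] dens by (simp add: power_0_left)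
    next
      case False
      have "(\<integral>\<^sup>+x. ennreal (?V * m * x ^ (m - 1)) * indicator {0..r} x \<partial>lborel) = 0"
        using False AE_lborel_singleton[of "0::real"]
        by (subst nn_integral_0_iff_AE) (auto elim!: eventually_mono simp: indicator_def)
      then show ?thesis using False unfolding dens by (simp add: neg)
    qed
  qed
  show "Int_stable (range (atMost :: real \<Rightarrow> _))"
    by (auto simp: Int_stable_def)
  show "emeasure (distr ?P borel ?n) X = emeasure (density lborel ?d) X" if "X \<in> range atMost" for X
    using that eq by auto
  show "(\<Union>i. {..real i}) = UNIV"
    using real_arch_simple by auto
  show "emeasure (distr ?P borel ?n) {..real i} \<noteq> \<infinity>" for i
  proof -
    have "emeasure (distr ?P borel ?n) {..real i} \<le> emeasure (distr ?P borel ?n) {..real (Suc i)}"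
      by (intro emeasure_mono) auto
    also have "\<dots> < \<infinity>" by (subst pos) auto
    finally show ?thesis by simp
  qed
qed (auto simp: borel_eq_atMost)

section \<open>Gaussian measure of double cones\<close>

text \<open>
  For a unit vector $u$, these are the two circular cones around the axis through $u$ with opening
  angle $\arctan\tau$.
\<close>
definition double_cone :: "real \<Rightarrow> 'a::real_inner \<Rightarrow> 'a set"
  where "double_cone \<tau> u = {x. norm (x - (x \<bullet> u) *\<^sub>R u) \<le> \<tau> * \<bar>x \<bullet> u\<bar>}"

lemma closed_double_cone: "closed (double_cone \<tau> u)"
  unfolding double_cone_def by (intro closed_Collect_le continuous_intros)

text \<open>
  For a Gaussian vector $x$ and a coordinate axis $e$, let $s$ be the slope at which $x$ leaves the axis,
  that is the length of the component orthogonal to $e$ divided by the length of the component along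
  $e$. With $m + 1$ the dimension, $s$ has a density proportional to $s^{m-1} (1+s^2)^{-(m+1)/2}$.
  To see this, write $t$ for the component along $e$ and $r$ for the norm of the rest. The pair has a
  density proportional to $r^{m-1} e^{-(t^2+r^2)/2}$; substituting $r = |t| s$ and integrating out $t$
  after rescaling it by $\sqrt{1+s^2}$ leaves this power of $1+s^2$. The constant $K$ stays unspecified
  because only ratios of integrals are needed.
\<close>
lemma gaussian_slope_law:
  fixes e :: "'a::euclidean_space"
  assumes e: "e \<in> Basis" and dim: "DIM('a) = Suc m" "m > 0"
  obtains K :: ennreal where "\<And>h :: real \<Rightarrow> ennreal. h \<in> borel_measurable borel \<Longrightarrow>
    (\<integral>\<^sup>+x. ennreal (exp (- (norm x)\<^sup>2 / 2)) * h (norm (x - (x \<bullet> e) *\<^sub>R e) / \<bar>x \<bullet> e\<bar>) \<partial>lborel) =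
    K * (\<integral>\<^sup>+s. h s * ennreal (s ^ (m - 1) / sqrt (1 + s\<^sup>2) ^ (m + 1)) * indicator {0..} s \<partial>lborel)"
proof (rule that)
  fix h :: "real \<Rightarrow> ennreal" assume [measurable]: "h \<in> borel_measurable borel"
  define I where "I = Basis - {e}"
  have card_I: "card I = m"
    using e dim by (simp add: I_def card_Diff_singleton)
  then have "I \<noteq> {}" using dim(2) by auto
  with card_I have I: "finite I" "e \<notin> I" "insert e I = Basis" "card I = m" "I \<noteq> {}"
    using e dim(2) by (auto simp: I_def )
  define V where "V = unit_ball_vol (real m) * m"
  have V: "V \<ge> 0" by (simp add: V_def)
  define F where "F = (\<lambda>t r. ennreal (exp (- (t\<^sup>2 + r\<^sup>2) / 2)) * h (r / \<bar>t\<bar>))"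
  have F': "(\<lambda>x. F (f x) (g x)) \<in> borel_measurable N" if "f \<in> borel_measurable N" "g \<in> borel_measurable N" for f g N
    unfolding F_def using that by measurable
  have [measurable]: "F t \<in> borel_measurable borel" for t
    unfolding F_def by measurable
  let ?n = "\<lambda>f. sqrt (\<Sum>i\<in>I. (f i)\<^sup>2)"
  let ?K = "\<integral>\<^sup>+t. ennreal (V * \<bar>t\<bar> ^ m * exp (- t\<^sup>2 / 2)) \<partial>lborel"
  interpret product_sigma_finite "\<lambda>_::'a. lborel :: real measure" by standard
  have comp: "ennreal (exp (- (norm x)\<^sup>2 / 2)) * h (norm (x - (x \<bullet> e) *\<^sub>R e) / \<bar>x \<bullet> e\<bar>) = F (f e) (?n f)"
    if x: "x = (\<Sum>b\<in>Basis. f b *\<^sub>R b)" for x f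
  proof -
    have fb: "x \<bullet> b = f b" if "b \<in> Basis" for b using that by (simp add: x)
    have "(norm x)\<^sup>2 = (\<Sum>b\<in>Basis. (f b)\<^sup>2)"
      by (simp add: norm_eq_sqrt_inner euclidean_inner[of x x] sum_nonneg fb power2_eq_square)
    also have "\<dots> = (f e)\<^sup>2 + (?n f)\<^sup>2"
      using I(1,2) by (subst I(3)[symmetric]) (simp add: sum_nonneg)
    finally have 1: "(norm x)\<^sup>2 = (f e)\<^sup>2 + (?n f)\<^sup>2" .
    have "(norm (x - (x \<bullet> e) *\<^sub>R e))\<^sup>2 = (norm x)\<^sup>2 - (x \<bullet> e)\<^sup>2"
      unfolding power2_norm_eq_inner using inner_same_Basis[OF e]
      by (simp add: inner_diff inner_commute algebra_simps power2_eq_square)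
    then have "(norm (x - (x \<bullet> e) *\<^sub>R e))\<^sup>2 = (?n f)\<^sup>2"
      using 1 fb e by simp
    then have "norm (x - (x \<bullet> e) *\<^sub>R e) = ?n f"
      by (rule power2_eq_imp_eq) (simp_all add: sum_nonneg)
    then show ?thesis by (simp add: F_def 1 fb e)
  qed
  have "(\<integral>\<^sup>+x. ennreal (exp (- (norm x)\<^sup>2 / 2)) * h (norm (x - (x \<bullet> e) *\<^sub>R e) / \<bar>x \<bullet> e\<bar>) \<partial>lborel)
      = (\<integral>\<^sup>+f. F (f e) (?n f) \<partial>(\<Pi>\<^sub>M b\<in>Basis. lborel))"
    by (subst lborel_eq, subst nn_integral_distr)
      (measurable, rule nn_integral_cong, rule comp, rule refl)
  also have "\<dots> = (\<integral>\<^sup>+t. \<integral>\<^sup>+f. F t (?n f) \<partial>(\<Pi>\<^sub>M b\<in>I. lborel) \<partial>lborel)"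
  proof -
    have "(\<lambda>f. F (f e) (?n f)) \<in> borel_measurable (\<Pi>\<^sub>M b\<in>insert e I. lborel)"
      by (rule F') measurable
    moreover have "?n (f(e := t)) = ?n f" for f t
      using I(2) by (intro arg_cong[where f=sqrt] sum.cong) auto
    ultimately show ?thesis
      unfolding I(3)[symmetric] using I by (subst product_nn_integral_insert_rev) auto
  qed
  also have "\<dots> = (\<integral>\<^sup>+t. \<integral>\<^sup>+r. F t r \<partial>distr (\<Pi>\<^sub>M b\<in>I. lborel) borel ?n \<partial>lborel)"
  proof (rule nn_integral_cong)
    fix t :: real
    have "?n \<in> borel_measurable (\<Pi>\<^sub>M b\<in>I. lborel)" by measurable
    then show "(\<integral>\<^sup>+f. F t (?n f) \<partial>(\<Pi>\<^sub>M b\<in>I. lborel)) = (\<integral>\<^sup>+r. F t r \<partial>distr (\<Pi>\<^sub>M b\<in>I. lborel) borel ?n)"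
      by (subst nn_integral_distr) auto
  qed
  also have "\<dots> = (\<integral>\<^sup>+t. \<integral>\<^sup>+r. ennreal (V * r ^ (m - 1)) * indicator {0..} r * F t r \<partial>lborel \<partial>lborel)"
    unfolding radial_distr_lborel[OF I(1,5)] I(4) V_def
    by (rule nn_integral_cong, subst nn_integral_density) auto
  also have "\<dots> = (\<integral>\<^sup>+t. \<integral>\<^sup>+s. ennreal (V * \<bar>t\<bar> ^ m * exp (- t\<^sup>2 * (1 + s\<^sup>2) / 2)) *
      (h s * ennreal (s ^ (m - 1)) * indicator {0..} s) \<partial>lborel \<partial>lborel)"
  proof (rule nn_integral_cong_AE, rule eventually_mono[OF AE_lborel_singleton[of "0::real"]])
    fix t :: real assume t: "t \<noteq> 0"
    have "(\<integral>\<^sup>+r. ennreal (V * r ^ (m - 1)) * indicator {0..} r * F t r \<partial>lborel) =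
      ennreal \<bar>t\<bar> * (\<integral>\<^sup>+s. ennreal (V * (\<bar>t\<bar> * s) ^ (m - 1)) * indicator {0..} (\<bar>t\<bar> * s) * F t (\<bar>t\<bar> * s) \<partial>lborel)"
      using t by (subst nn_integral_real_affine[where c="\<bar>t\<bar>" and t=0]) auto
    also have "\<dots> = (\<integral>\<^sup>+s. ennreal \<bar>t\<bar> * (ennreal (V * (\<bar>t\<bar> * s) ^ (m - 1)) * indicator {0..} (\<bar>t\<bar> * s) * F t (\<bar>t\<bar> * s)) \<partial>lborel)"
      by (subst nn_integral_cmult) auto
    also have "\<dots> = (\<integral>\<^sup>+s. ennreal (V * \<bar>t\<bar> ^ m * exp (- t\<^sup>2 * (1 + s\<^sup>2) / 2)) *
      (h s * ennreal (s ^ (m - 1)) * indicator {0..} s) \<partial>lborel)"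
    proof (rule nn_integral_cong)
      fix s :: real
      show "ennreal \<bar>t\<bar> * (ennreal (V * (\<bar>t\<bar> * s) ^ (m - 1)) * indicator {0..} (\<bar>t\<bar> * s) * F t (\<bar>t\<bar> * s)) =
        ennreal (V * \<bar>t\<bar> ^ m * exp (- t\<^sup>2 * (1 + s\<^sup>2) / 2)) * (h s * ennreal (s ^ (m - 1)) * indicator {0..} s)"
      proof (cases "s \<ge> 0")
        case True
        have "\<bar>t\<bar> ^ m = \<bar>t\<bar> * \<bar>t\<bar> ^ (m - 1)" using dim by (cases m) auto
        moreover have "- (t\<^sup>2 + (\<bar>t\<bar> * s)\<^sup>2) / 2 = - t\<^sup>2 * (1 + s\<^sup>2) / 2"
          by (simp add: power_mult_distrib algebra_simps)
        ultimately show ?thesis using True t V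
          by (simp add: F_def ennreal_mult' power_mult_distrib mult_ac)
      qed (use t in \<open>auto simp: indicator_def zero_le_mult_iff\<close>)
    qed
    finally show "(\<integral>\<^sup>+r. ennreal (V * r ^ (m - 1)) * indicator {0..} r * F t r \<partial>lborel) =
      (\<integral>\<^sup>+s. ennreal (V * \<bar>t\<bar> ^ m * exp (- t\<^sup>2 * (1 + s\<^sup>2) / 2)) *
      (h s * ennreal (s ^ (m - 1)) * indicator {0..} s) \<partial>lborel)" .
  qed
  also have "\<dots> = (\<integral>\<^sup>+s. \<integral>\<^sup>+t. ennreal (V * \<bar>t\<bar> ^ m * exp (- t\<^sup>2 * (1 + s\<^sup>2) / 2)) *
      (h s * ennreal (s ^ (m - 1)) * indicator {0..} s) \<partial>lborel \<partial>lborel)"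
    by (rule lborel_pair.Fubini') measurable
  also have "\<dots> = (\<integral>\<^sup>+s. ?K * (h s * ennreal (s ^ (m - 1) / sqrt (1 + s\<^sup>2) ^ (m + 1)) * indicator {0..} s) \<partial>lborel)"
  proof (rule nn_integral_cong)
    fix s :: real
    define q where "q = sqrt (1 + s\<^sup>2)"
    have q: "q > 0" "q\<^sup>2 = 1 + s\<^sup>2" by (auto simp: q_def add_pos_nonneg)
    have "(\<integral>\<^sup>+t. ennreal (V * \<bar>t\<bar> ^ m * exp (- t\<^sup>2 * (1 + s\<^sup>2) / 2)) \<partial>lborel) =
      ennreal \<bar>1 / q\<bar> * (\<integral>\<^sup>+t. ennreal (V * \<bar>0 + 1 / q * t\<bar> ^ m * exp (- (0 + 1 / q * t)\<^sup>2 * (1 + s\<^sup>2) / 2)) \<partial>lborel)"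
      using q by (intro nn_integral_real_affine) auto
    also have "\<dots> = (\<integral>\<^sup>+t. ennreal (1 / q ^ (m + 1)) * ennreal (V * \<bar>t\<bar> ^ m * exp (- t\<^sup>2 / 2)) \<partial>lborel)"
      using q V by (subst nn_integral_cmult[symmetric])
        (auto intro!: nn_integral_cong arg_cong[where f=ennreal] simp: ennreal_mult'[symmetric] abs_mult power_mult_distrib power_divide simp flip: q(2))
    also have "\<dots> = ennreal (1 / q ^ (m + 1)) * ?K"
      by (rule nn_integral_cmult) simp
    finally have "(\<integral>\<^sup>+t. ennreal (V * \<bar>t\<bar> ^ m * exp (- t\<^sup>2 * (1 + s\<^sup>2) / 2)) *
      (h s * ennreal (s ^ (m - 1)) * indicator {0..} s) \<partial>lborel) =
      ennreal (1 / q ^ (m + 1)) * ?K * (h s * ennreal (s ^ (m - 1)) * indicator {0..} s)"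
      by (subst nn_integral_multc) auto
    also have "\<dots> = ?K * (h s * ennreal (s ^ (m - 1) / q ^ (m + 1)) * indicator {0..} s)"
    proof (cases "s \<ge> 0")
      case True
      have "ennreal (s ^ (m - 1) / q ^ (m + 1)) = ennreal (1 / q ^ (m + 1)) * ennreal (s ^ (m - 1))"
        using True q by (subst ennreal_mult'[symmetric]) auto
      then show ?thesis by (simp add: mult_ac)
    qed auto
    finally show "(\<integral>\<^sup>+t. ennreal (V * \<bar>t\<bar> ^ m * exp (- t\<^sup>2 * (1 + s\<^sup>2) / 2)) *
      (h s * ennreal (s ^ (m - 1)) * indicator {0..} s) \<partial>lborel) =
      ?K * (h s * ennreal (s ^ (m - 1) / sqrt (1 + s\<^sup>2) ^ (m + 1)) * indicator {0..} s)"
      by (simp add: q_def)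
  qed
  also have "\<dots> = ?K * (\<integral>\<^sup>+s. h s * ennreal (s ^ (m - 1) / sqrt (1 + s\<^sup>2) ^ (m + 1)) * indicator {0..} s \<partial>lborel)"
    by (rule nn_integral_cmult) measurable
  finally show "(\<integral>\<^sup>+x. ennreal (exp (- (norm x)\<^sup>2 / 2)) * h (norm (x - (x \<bullet> e) *\<^sub>R e) / \<bar>x \<bullet> e\<bar>) \<partial>lborel) =
    (\<integral>\<^sup>+t. ennreal (unit_ball_vol (real m) * m * \<bar>t\<bar> ^ m * exp (- t\<^sup>2 / 2)) \<partial>lborel) * (\<integral>\<^sup>+s. h s * ennreal (s ^ (m - 1) / sqrt (1 + s\<^sup>2) ^ (m + 1)) * indicator {0..} s \<partial>lborel)"
    by (simp only: V_def)
qed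

text \<open>
  With $c = 1/\sqrt{1+s^2}$, the cosine of the opening angle, the function $R^m = (1-c)^{m/2}$ vanishes
  at $s = 0$ and tends to $1$ at infinity. The integrand $f$ of $J$ and the derivative $Q'$ of $R^m$ are
  related by $f = \frac 2 m (1+c)^{m/2-1} Q'$, and since $1 \le 1+c \le 2$ the quotient $f/Q'$ varies by a
  factor of at most $2^{m/2}$. Hence the share of $J$ that lies below $\tau$ is at least
  $2^{-m/2} R(\tau)^m$.
\<close>
lemma slope_integral_bound:
  fixes m :: nat and \<tau> :: real
  assumes m: "m > 0" and \<tau>: "\<tau> > 0"
  defines "J \<equiv> \<lambda>T. (\<integral>\<^sup>+s. ennreal (s ^ (m - 1) / sqrt (1 + s\<^sup>2) ^ (m + 1)) * indicator T s \<partial>lborel)"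
  shows "ennreal ((1 / 2 * (1 - 1 / sqrt (1 + \<tau>\<^sup>2))) powr (real m / 2)) * J {0..} \<le> J {0..\<tau>}"
proof -
  define q where "q = (\<lambda>s::real. sqrt (1 + s\<^sup>2))"
  define D where "D = (\<lambda>s. sqrt ((q s)\<^sup>2 + q s))"
  define R where "R = (\<lambda>s. s / D s)"
  define Q' where "Q' = (\<lambda>s. real m * R s ^ (m - 1) * (D s / (2 * q s ^ 3)))"
  define f where "f = (\<lambda>s::real. s ^ (m - 1) / q s ^ (m + 1))"
  define a where "a = 2 / m / sqrt 2"
  have q1: "q s \<ge> 1" and q2: "(q s)\<^sup>2 = 1 + s\<^sup>2" for s
    by (auto simp: q_def)
  have q0: "q s > 0" for s using q1[of s] by linarith
  have D0: "D s > 0" and D2: "(D s)\<^sup>2 = (q s)\<^sup>2 + q s" for s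
    using q0[of s] by (auto simp: D_def add_nonneg_pos)
  \<comment> \<open>$R$ is $\sqrt{1-c}$, written as a quotient that is smooth at $s = 0$.\<close>
  have R2: "(R s)\<^sup>2 = 1 - 1 / q s" for s
  proof -
    have "(R s)\<^sup>2 = ((q s)\<^sup>2 - 1) / ((q s)\<^sup>2 + q s)"
      by (simp add: R_def power_divide D2 q2)
    also have "\<dots> = ((q s - 1) * (q s + 1)) / (q s * (q s + 1))"
      by (simp add: algebra_simps power2_eq_square)
    also have "\<dots> = (q s - 1) / q s"
      using q1[of s] by (intro mult_divide_mult_cancel_right) linarith
    also have "\<dots> = 1 - 1 / q s"
      using q0[of s] by (simp add: diff_divide_distrib)
    finally show ?thesis .
  qed
  have R_deriv: "(R has_real_derivative D s / (2 * q s ^ 3)) (at s)" for s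
  proof -
    have dq: "(q has_real_derivative s / q s) (at s)" for s
      unfolding q_def using q2[of s] q0[of s]
      by (auto intro!: derivative_eq_intros simp: q_def divide_simps add_nonneg_eq_0_iff not_less)
    have "0 < (q s)\<^sup>2 + q s" using q0[of s] by (simp add: add_pos_pos)
    moreover have "((\<lambda>s. (q s)\<^sup>2 + q s) has_real_derivative 2 * q s * (s / q s) + s / q s) (at s)"
      by (auto intro!: derivative_eq_intros dq)
    ultimately have "(D has_real_derivative inverse (sqrt ((q s)\<^sup>2 + q s)) / 2 * (2 * q s * (s / q s) + s / q s)) (at s)"
      unfolding D_def by (intro DERIV_chain2[OF DERIV_real_sqrt])
    then have dD: "(D has_real_derivative (2 * q s * (s / q s) + s / q s) / (2 * D s)) (at s)"
      unfolding D_def[symmetric] D_def[THEN fun_cong, symmetric] by (simp add: D_def field_simps)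
    have "(R has_real_derivative (1 * D s - s * ((2 * q s * (s / q s) + s / q s) / (2 * D s))) / (D s * D s)) (at s)"
      unfolding R_def by (intro DERIV_divide DERIV_ident dD) (use D0[of s] in auto)
    moreover have "(1 * D s - s * ((2 * q s * (s / q s) + s / q s) / (2 * D s))) / (D s * D s) = D s / (2 * q s ^ 3)"
    proof -
      have ss: "s * s = (q s - 1) * (q s + 1)" and DD: "D s * D s = q s * (q s + 1)"
        using q2[of s] D2[of s] by (auto simp: power2_eq_square algebra_simps)
      have "(1 * D s - s * ((2 * q s * (s / q s) + s / q s) / (2 * D s))) / (D s * D s) =
          (2 * q s * (D s * D s) - (s * s) * (2 * q s + 1)) / (2 * q s * D s * (D s * D s))"
        using q0[of s] D0[of s] by (simp add: field_simps)
      also have "2 * q s * (D s * D s) - (s * s) * (2 * q s + 1) = (q s + 1) * (q s + 1)"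
        unfolding ss DD by (simp add: algebra_simps)
      also have "2 * q s * D s * (D s * D s) = (2 * (q s)\<^sup>2 * D s) * (q s + 1)"
        unfolding DD by (simp add: power2_eq_square)
      also have "(q s + 1) * (q s + 1) / ((2 * (q s)\<^sup>2 * D s) * (q s + 1)) = (q s + 1) / (2 * (q s)\<^sup>2 * D s)"
        using q0[of s] by (intro mult_divide_mult_cancel_right) linarith
      also have "\<dots> = D s * D s / (2 * q s ^ 3 * D s)"
        unfolding DD using q0[of s] D0[of s] by (simp add: power2_eq_square power3_eq_cube)
      also have "\<dots> = D s / (2 * q s ^ 3)"
        using D0[of s] by (intro mult_divide_mult_cancel_right) linarith
      finally show ?thesis .
    qed
    ultimately show ?thesis by simp
  qed
  have Q_deriv: "((\<lambda>s. R s ^ m) has_real_derivative Q' s) (at s)" for s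
    using DERIV_power[OF R_deriv[of s], of m] by (simp add: Q'_def mult_ac)
  have q_cont: "continuous_on UNIV q"
    unfolding q_def by (intro continuous_intros)
  have D_cont: "continuous_on UNIV D"
    unfolding D_def by (intro continuous_intros q_cont)
  have [measurable]: "q \<in> borel_measurable borel" "D \<in> borel_measurable borel"
    using q_cont D_cont by (auto intro: borel_measurable_continuous_onI)
  have [measurable]: "Q' \<in> borel_measurable borel" "f \<in> borel_measurable borel"
    unfolding Q'_def R_def f_def by measurable
  have Q'_nonneg: "Q' s \<ge> 0" if "s \<ge> 0" for s
    using that D0[of s] q0[of s] by (simp add: Q'_def R_def)
  have a: "a > 0" using m by (simp add: a_def)
  \<comment> \<open>Here $z = \sqrt{1+c}$ lies in $[1,\sqrt 2]$, and $f = \frac 2 m z^{m-2} Q'$; writing $z^{m-2}$ as $z^{m-1}/z$ covers $m = 1$ as well.\<close>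
  have bounds: "a * Q' s \<le> f s \<and> f s \<le> a * sqrt 2 ^ m * Q' s" if s: "s \<ge> 0" for s
  proof -
    define z where "z = D s / q s"
    have z0: "z > 0" using D0[of s] q0[of s] by (simp add: z_def)
    have z2: "z\<^sup>2 = 1 + 1 / q s"
      unfolding z_def power_divide D2 using q0[of s] by (simp add: add_divide_distrib power2_eq_square)
    have "1\<^sup>2 \<le> z\<^sup>2" using q0[of s] unfolding z2 by simp
    then have z1: "1 \<le> z" using z0 power2_le_imp_le[of 1 z] by simp
    have "z\<^sup>2 \<le> (sqrt 2)\<^sup>2" using q1[of s] unfolding z2 by (simp add: field_simps)
    then have zs: "z \<le> sqrt 2" by (rule power2_le_imp_le) simp
    obtain l where l: "m = Suc l" using m by (cases m) auto
    have f_eq: "f s = 2 / m * (z ^ (m - 1) / z) * Q' s"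
    proof -
      have "z ^ l * R s ^ l = (s / q s) ^ l"
        using D0[of s] by (simp add: z_def R_def flip: power_mult_distrib)
      moreover have "2 / m * (z ^ (m - 1) / z) * Q' s = z ^ l * R s ^ l * (D s / (z * q s ^ 3))"
        using m by (simp add: Q'_def l del: of_nat_Suc)
      moreover have "D s / (z * q s ^ 3) = 1 / (q s)\<^sup>2"
        using D0[of s] q0[of s] by (simp add: z_def power2_eq_square power3_eq_cube)
      ultimately show ?thesis
        by (simp add: f_def l power_divide power2_eq_square mult_ac)
    qed
    have "1 / sqrt 2 \<le> z ^ (m - 1) / z"
      using z1 z0 zs by (intro frac_le) auto
    moreover have "z ^ (m - 1) / z \<le> sqrt 2 ^ (m - 1) / 1"
      using z1 z0 zs by (intro frac_le power_mono) auto
    moreover have "sqrt 2 ^ (m - 1) / 1 = sqrt 2 ^ m / sqrt (2::real)"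
      by (simp add: l)
    ultimately have "2 / m * (1 / sqrt 2) * Q' s \<le> f s" "f s \<le> 2 / m * (sqrt 2 ^ m / sqrt 2) * Q' s"
      unfolding f_eq using Q'_nonneg[OF s] by (intro mult_right_mono mult_left_mono; simp)+
    then show ?thesis by (simp add: a_def)
  qed
  have lim: "((\<lambda>s. R s ^ m) \<longlongrightarrow> 1) at_top"
  proof -
    have "((\<lambda>s. s / sqrt (1 + s\<^sup>2 + sqrt (1 + s\<^sup>2))) \<longlongrightarrow> (1::real)) at_top"
      by real_asymp
    then have "(R \<longlongrightarrow> 1) at_top"
      by (simp add: R_def D_def q_def)
    then have "((\<lambda>s. R s ^ m) \<longlongrightarrow> 1 ^ m) at_top" by (rule tendsto_power)
    then show ?thesis by simp
  qed
  have R0: "R 0 ^ m = 0" using m by (simp add: R_def)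
  have Q_int: "(\<integral>\<^sup>+s. ennreal (Q' s) * indicator {0..\<tau>} s \<partial>lborel) = ennreal (R \<tau> ^ m)"
    using nn_integral_FTC_Icc[of Q' 0 \<tau> "\<lambda>s. R s ^ m"] Q_deriv Q'_nonneg \<tau> by (simp add: R0)
  have Q_total: "(\<integral>\<^sup>+s. ennreal (Q' s) * indicator {0..} s \<partial>lborel) = 1"
    using nn_integral_FTC_atLeast[of Q' 0 "\<lambda>s. R s ^ m" 1] Q_deriv Q'_nonneg lim by (simp add: R0)
  have J: "J T = (\<integral>\<^sup>+s. ennreal (f s) * indicator T s \<partial>lborel)" for T
    by (simp add: J_def f_def q_def)
  have lower: "ennreal a * ennreal (R \<tau> ^ m) \<le> J {0..\<tau>}"
    unfolding J Q_int[symmetric] using a bounds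
    by (subst nn_integral_cmult[symmetric])
      (auto intro!: nn_integral_mono simp: indicator_def ennreal_mult'[symmetric] ennreal_leI)
  have upper: "J {0..} \<le> ennreal (a * sqrt 2 ^ m)"
  proof -
    have "J {0..} \<le> (\<integral>\<^sup>+s. ennreal (a * sqrt 2 ^ m) * (ennreal (Q' s) * indicator {0..} s) \<partial>lborel)"
      unfolding J using a bounds
      by (intro nn_integral_mono) (auto simp: indicator_def ennreal_mult'[symmetric] ennreal_leI)
    also have "\<dots> = ennreal (a * sqrt 2 ^ m)"
      by (subst nn_integral_cmult) (auto simp: Q_total)
    finally show ?thesis .
  qed
  have R_pos: "R \<tau> > 0" using \<tau> D0[of \<tau>] by (simp add: R_def)
  have k: "(1 / 2 * (1 - 1 / sqrt (1 + \<tau>\<^sup>2))) powr (real m / 2) = R \<tau> ^ m / sqrt 2 ^ m"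
  proof -
    have "1 / 2 * (1 - 1 / sqrt (1 + \<tau>\<^sup>2)) = (R \<tau> / sqrt 2)\<^sup>2"
      using R2[of \<tau>] by (simp add: q_def power_divide)
    also have "\<dots> = (R \<tau> / sqrt 2) powr 2"
      using R_pos by (simp add: powr_numeral)
    finally have "(1 / 2 * (1 - 1 / sqrt (1 + \<tau>\<^sup>2))) powr (real m / 2) = (R \<tau> / sqrt 2) powr real m"
      by (simp add: powr_powr)
    also have "\<dots> = (R \<tau> / sqrt 2) ^ m"
      using R_pos by (simp add: powr_realpow)
    finally show ?thesis by (simp add: power_divide)
  qed
  have "ennreal (R \<tau> ^ m / sqrt 2 ^ m) * J {0..} \<le> ennreal (R \<tau> ^ m / sqrt 2 ^ m) * ennreal (a * sqrt 2 ^ m)"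
    by (intro mult_left_mono upper) auto
  also have "\<dots> = ennreal a * ennreal (R \<tau> ^ m)"
    using a R_pos by (simp add: ennreal_mult'[symmetric])
  also note lower
  finally show ?thesis unfolding k .
qed

lemma AE_inner_nonzero:
  fixes a :: "'a::euclidean_space"
  assumes "a \<noteq> 0"
  shows "AE x in lborel. a \<bullet> x \<noteq> 0"
proof -
  have "negligible {x. a \<bullet> x = 0}"
    using assms by (intro negligible_hyperplane) auto
  then have "{x. a \<bullet> x = 0} \<in> null_sets lborel"
    by (subst null_sets_completion_iff[symmetric]) (auto simp: negligible_iff_null_sets)
  then show ?thesis by (rule AE_I') auto
qed
text \<open>
  The weight is left unnormalised, so the claim is that the double cone carries at least the stated
  share of the total mass. This share is the spherical cap estimate: a pair of opposite caps of
  angular radius $\theta$ covers at least the fraction $\sin(\theta/2)^{n-1}$ of the sphere, where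
  $\cos\theta = 1/\sqrt{1+\tau^2}$. In dimension one the cone is the whole line.
\<close>
lemma double_cone_Basis_bound:
  fixes e :: "'a::euclidean_space"
  assumes e: "e \<in> Basis" and \<tau>: "\<tau> > 0"
  defines "W \<equiv> density lborel (\<lambda>x::'a. ennreal (exp (- (norm x)\<^sup>2 / 2)))"
  shows "ennreal ((1 / 2 * (1 - 1 / sqrt (1 + \<tau>\<^sup>2))) powr ((real DIM('a) - 1) / 2)) * emeasure W UNIV
    \<le> emeasure W (double_cone \<tau> e)"
proof (cases "DIM('a) = 1")
  case True
  then have B: "Basis = {e}" using e by (metis card_1_singletonE singletonD)
  have "x = (x \<bullet> e) *\<^sub>R e" for x :: 'a
    using euclidean_representation[of x] unfolding B by simp
  then have "double_cone \<tau> e = UNIV"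
    using \<tau> by (auto simp: double_cone_def)
  moreover have "1 / sqrt (1 + \<tau>\<^sup>2) < 1" using \<tau> by (subst divide_less_eq_1_pos) (auto simp: add_pos_nonneg)
  ultimately show ?thesis using True by simp
next
  case False
  then obtain m where m: "DIM('a) = Suc m" "m > 0"
    using DIM_positive[where 'a='a] by (cases "DIM('a)") auto
  from gaussian_slope_law[OF e m] obtain K where K:
    "\<And>h :: real \<Rightarrow> ennreal. h \<in> borel_measurable borel \<Longrightarrow>
      (\<integral>\<^sup>+x. ennreal (exp (- (norm x)\<^sup>2 / 2)) * h (norm (x - (x \<bullet> e) *\<^sub>R e) / \<bar>x \<bullet> e\<bar>) \<partial>lborel) =
      K * (\<integral>\<^sup>+s. h s * ennreal (s ^ (m - 1) / sqrt (1 + s\<^sup>2) ^ (m + 1)) * indicator {0..} s \<partial>lborel)"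
    by blast
  define J where "J = (\<lambda>T. (\<integral>\<^sup>+s. ennreal (s ^ (m - 1) / sqrt (1 + s\<^sup>2) ^ (m + 1)) * indicator T s \<partial>lborel))"
  have total: "emeasure W UNIV = K * J {0..}"
    using K[of "\<lambda>_. 1"] by (simp add: W_def J_def emeasure_density)
  have cone_sets [measurable]: "double_cone \<tau> e \<in> sets borel"
    by (intro borel_closed closed_double_cone)
  have ae: "AE x in lborel. x \<bullet> e \<noteq> 0"
    using AE_inner_nonzero[of e] e by (simp add: inner_commute nonzero_Basis)
  have "emeasure W (double_cone \<tau> e) =
      (\<integral>\<^sup>+x. ennreal (exp (- (norm x)\<^sup>2 / 2)) * indicator (double_cone \<tau> e) x \<partial>lborel)"
    by (simp add: W_def emeasure_density)
  also have "\<dots> = (\<integral>\<^sup>+x. ennreal (exp (- (norm x)\<^sup>2 / 2)) *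
      indicator {..\<tau>} (norm (x - (x \<bullet> e) *\<^sub>R e) / \<bar>x \<bullet> e\<bar>) \<partial>lborel)"
  proof (rule nn_integral_cong_AE, rule eventually_mono[OF ae])
    fix x :: 'a assume "x \<bullet> e \<noteq> 0"
    then have "x \<in> double_cone \<tau> e \<longleftrightarrow> norm (x - (x \<bullet> e) *\<^sub>R e) / \<bar>x \<bullet> e\<bar> \<in> {..\<tau>}"
      by (simp add: double_cone_def divide_le_eq)
    then show "ennreal (exp (- (norm x)\<^sup>2 / 2)) * indicator (double_cone \<tau> e) x =
      ennreal (exp (- (norm x)\<^sup>2 / 2)) * indicator {..\<tau>} (norm (x - (x \<bullet> e) *\<^sub>R e) / \<bar>x \<bullet> e\<bar>)"
      by (simp add: indicator_def)
  qed
  also have "\<dots> = K * (\<integral>\<^sup>+s. indicator {..\<tau>} s * ennreal (s ^ (m - 1) / sqrt (1 + s\<^sup>2) ^ (m + 1)) * indicator {0..} s \<partial>lborel)"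
    by (rule K) simp
  also have "\<dots> = K * J {0..\<tau>}"
    unfolding J_def by (intro arg_cong[where f="(*) K"] nn_integral_cong) (auto simp: indicator_def)
  finally have cone: "emeasure W (double_cone \<tau> e) = K * J {0..\<tau>}" .
  have "K * (ennreal ((1 / 2 * (1 - 1 / sqrt (1 + \<tau>\<^sup>2))) powr (real m / 2)) * J {0..}) \<le> K * J {0..\<tau>}"
    unfolding J_def by (intro mult_left_mono slope_integral_bound[OF m(2) \<tau>]) simp
  then show ?thesis
    by (simp add: total cone m mult_ac)
qed

text \<open>
  The density depends on the norm only, so a rotation carries the cone around $u$ to a cone around a
  coordinate axis without changing its mass.
\<close>
lemma double_cone_gaussian_bound:
  fixes u :: "real ^ 'n"
  assumes u: "norm u = 1" and \<tau>: "\<tau> > 0"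
  defines "\<gamma> \<equiv> density lborel (\<lambda>x::real ^ 'n. ennreal (std_gaussian_density x))"
  shows "ennreal ((1 / 2 * (1 - 1 / sqrt (1 + \<tau>\<^sup>2))) powr ((real CARD('n) - 1) / 2)) * emeasure \<gamma> UNIV
    \<le> emeasure \<gamma> (double_cone \<tau> u)"
proof -
  define W where "W = density lborel (\<lambda>x::real ^ 'n. ennreal (exp (- (norm x)\<^sup>2 / 2)))"
  define C where "C = (1 / sqrt (2 * pi)) ^ CARD('n)"
  have C: "C \<ge> 0" by (simp add: C_def)
  have g: "std_gaussian_density x = C * exp (- (norm x)\<^sup>2 / 2)" for x :: "real ^ 'n"
  proof -
    have "std_gaussian_density x = C * exp (\<Sum>i\<in>UNIV. - (x $ i)\<^sup>2 / 2)"
      unfolding std_gaussian_density_def C_def std_normal_density_def exp_sum[OF finite]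
      by (simp add: prod_dividef power_divide)
    also have "(\<Sum>i\<in>UNIV. - (x $ i)\<^sup>2 / 2) = - (norm x)\<^sup>2 / 2"
      unfolding power2_norm_eq_inner
      by (simp add: inner_vec_def power2_eq_square sum_negf sum_divide_distrib)
    finally show ?thesis .
  qed
  have gW: "emeasure \<gamma> A = ennreal C * emeasure W A" if "A \<in> sets borel" for A
  proof -
    have "emeasure \<gamma> A = (\<integral>\<^sup>+x. ennreal C * (ennreal (exp (- (norm x)\<^sup>2 / 2)) * indicator A x) \<partial>lborel)"
      using that C unfolding \<gamma>_def g
      by (subst emeasure_density) (auto simp: ennreal_mult' mult_ac)
    also have "\<dots> = ennreal C * emeasure W A"
      using that unfolding W_def by (subst nn_integral_cmult) (auto simp: emeasure_density)
    finally show ?thesis .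
  qed
  define e :: "real ^ 'n" where "e = axis undefined 1"
  have e: "e \<in> Basis" by (auto simp: e_def Basis_vec_def)
  obtain f where f: "orthogonal_transformation f" "f u = e"
    using orthogonal_transformation_exists_1[of u e] u e by auto
  have lin: "linear f" and nf: "norm (f x) = norm x" and inf: "f x \<bullet> f y = x \<bullet> y" for x y
    using f(1) by (auto simp: orthogonal_transformation_def orthogonal_transformation_norm)
  have [measurable]: "f \<in> borel_measurable borel"
    using lin by (simp add: borel_measurable_continuous_onI linear_continuous_on linear_linear)
  have cone_sets [measurable]: "double_cone \<tau> v \<in> sets borel" for v :: "real ^ 'n"
    by (intro borel_closed closed_double_cone)
  have rot: "f x \<in> double_cone \<tau> e \<longleftrightarrow> x \<in> double_cone \<tau> u" for x
  proof -
    have "f x - (f x \<bullet> e) *\<^sub>R e = f (x - (x \<bullet> u) *\<^sub>R u)"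
      unfolding f(2)[symmetric] inf by (simp add: linear_diff[OF lin] linear_cmul[OF lin])
    moreover have "f x \<bullet> e = x \<bullet> u" unfolding f(2)[symmetric] inf ..
    ultimately show ?thesis by (simp add: double_cone_def nf)
  qed
  have "emeasure W (double_cone \<tau> e) =
      (\<integral>\<^sup>+x. ennreal (exp (- (norm x)\<^sup>2 / 2)) * indicator (double_cone \<tau> e) x \<partial>distr lborel borel f)"
    by (simp add: W_def emeasure_density lborel_distr_linear_isometry[OF lin nf])
  also have "\<dots> = (\<integral>\<^sup>+x. ennreal (exp (- (norm x)\<^sup>2 / 2)) * indicator (double_cone \<tau> u) x \<partial>lborel)"
    by (subst nn_integral_distr) (auto simp: nf rot indicator_def intro!: nn_integral_cong)
  also have "\<dots> = emeasure W (double_cone \<tau> u)"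
    by (simp add: W_def emeasure_density)
  finally have "emeasure W (double_cone \<tau> e) = emeasure W (double_cone \<tau> u)" .
  then show ?thesis
    using mult_left_mono[OF double_cone_Basis_bound[OF e \<tau>, folded W_def], of "ennreal C"]
    by (simp add: gW mult_ac)
qed

section \<open>Vertices of zonotopes\<close>

lemma zonotope_eq_image_cbox: "zonotope A = (\<lambda>x. A *v x) ` cbox (- 1) 1"
  by (auto simp: zonotope_def mem_box_cart)

lemma convex_zonotope: "convex (zonotope A)"
  unfolding zonotope_eq_image_cbox by (intro convex_linear_image convex_box) auto

lemma compact_zonotope: "compact (zonotope A)"
  unfolding zonotope_eq_image_cbox
  by (intro compact_continuous_image compact_cbox matrix_vector_mult_linear_continuous_on)

lemma zero_in_zonotope: "0 \<in> zonotope A"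
  unfolding zonotope_def by (auto intro!: exI[of _ 0])

lemma uminus_zonotope: "v \<in> zonotope A \<Longrightarrow> - v \<in> zonotope A"
proof -
  assume "v \<in> zonotope A"
  then obtain x where "v = A *v x" "\<forall>j. - 1 \<le> x $ j \<and> x $ j \<le> 1" by (auto simp: zonotope_def)
  then show ?thesis
    unfolding zonotope_def by (auto intro!: exI[of _ "- x"] simp: linear_neg[OF matrix_vector_mul_linear] minus_le_iff)
qed

lemma finite_vert_zonotope: "finite (vert (zonotope A))"
proof -
  have "polytope (zonotope A)"
    unfolding zonotope_eq_image_cbox by (intro polytope_linear_image polytope_interval) auto
  then show ?thesis
    unfolding vert_def by (simp add: finite_polyhedron_extreme_points polytope_imp_polyhedron)
qed

lemma convex_hull_vert_zonotope: "convex hull (vert (zonotope A)) = zonotope A"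
  unfolding vert_def by (rule Krein_Milman_Minkowski[OF compact_zonotope convex_zonotope, symmetric])

lemma vert_subset: "vert S \<subseteq> S"
  by (auto simp: vert_def extreme_point_of_def)

lemma uminus_vert:
  assumes "\<And>x. x \<in> S \<Longrightarrow> - x \<in> S" and "v \<in> vert S"
  shows "- v \<in> vert S"
  unfolding vert_def mem_Collect_eq extreme_point_of_def
proof (intro conjI ballI notI)
  show "- v \<in> S" using assms by (auto simp: vert_def extreme_point_of_def)
next
  fix a b assume ab: "a \<in> S" "b \<in> S" "- v \<in> open_segment a b"
  then have "v \<in> open_segment (- a) (- b)"
    using open_segment_linear_image[of uminus a b] by (force simp: linear_uminus image_iff)
  then show False using assms ab by (auto simp: vert_def extreme_point_of_def)
qed

lemma neq_uminus:
  fixes v :: "'a::real_vector"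
  assumes "v \<noteq> 0"
  shows "v \<noteq> - v"
proof
  assume "v = - v"
  then have "2 *\<^sub>R v = 0" by (metis add.right_inverse scaleR_2)
  then show False using assms by simp
qed
lemma zero_notin_vert_zonotope:
  assumes "column i A \<noteq> 0"
  shows "0 \<notin> vert (zonotope A)"
proof
  assume "0 \<in> vert (zonotope A)"
  moreover have c: "column i A \<in> zonotope A"
    unfolding zonotope_def
    by (auto intro!: exI[of _ "axis i 1"] simp: matrix_vector_mult_basis) (auto simp: axis_def)
  moreover have "0 \<in> open_segment (column i A) (- column i A)"
  proof -
    have "column i A \<noteq> - column i A" using assms by (rule neq_uminus)
    moreover have "0 = (1 - 1 / 2) *\<^sub>R column i A + (1 / 2) *\<^sub>R - column i A" by simp
    ultimately show ?thesis unfolding in_segment by (intro conjI exI[of _ "1/2"]) auto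
  qed
  ultimately show False
    using uminus_zonotope[OF c] by (auto simp: vert_def extreme_point_of_def)
qed

lemma unique_maximizer_is_vertex:
  fixes v :: "'a::real_inner"
  assumes v: "v \<in> S" and max: "\<And>z. z \<in> S \<Longrightarrow> z \<noteq> v \<Longrightarrow> x \<bullet> z < x \<bullet> v"
  shows "v \<in> vert S"
  unfolding vert_def mem_Collect_eq extreme_point_of_def
proof (intro conjI ballI notI v)
  fix a b assume ab: "a \<in> S" "b \<in> S" "v \<in> open_segment a b"
  then obtain t where t: "0 < t" "t < 1" "v = (1 - t) *\<^sub>R a + t *\<^sub>R b"
    by (auto simp: in_segment)
  have "a \<noteq> v" "b \<noteq> v" using ab(3) by (auto simp: open_segment_def)
  note t = t this
  have "x \<bullet> v = (1 - t) * (x \<bullet> a) + t * (x \<bullet> b)"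
    unfolding t(3) by (simp add: inner_add_right)
  also have "\<dots> < (1 - t) * (x \<bullet> v) + t * (x \<bullet> v)"
    using t max[OF ab(1)] max[OF ab(2)] by (intro add_strict_mono mult_strict_left_mono) auto
  finally show False by (simp add: algebra_simps)
qed

text \<open>
  For such an $x$ the vector $A^T x$ has no zero entry; these are the samples at which the sign vertex
  is the only maximiser of $x$ over the zonotope.
\<close>
definition generic_direction :: "real ^ 'm ^ 'n \<Rightarrow> real ^ 'n \<Rightarrow> bool"
  where "generic_direction A x \<longleftrightarrow> (\<forall>j. column j A \<bullet> x \<noteq> 0)"

lemma transpose_mult_nth: "(transpose A *v x) $ j = column j A \<bullet> (x :: real ^ 'n)"
  by (simp add: matrix_vector_mult_def transpose_def column_def inner_vec_def)

lemma sign_vertex_in_zonotope: "A *v sign_vec y \<in> zonotope A"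
  unfolding zonotope_def by (auto intro!: exI[of _ "sign_vec y"] simp: sign_vec_def)

text \<open>
  On $A y$ the functional $x$ takes the value $\sum_j \langle a_j, x\rangle y_j$, whose terms are maximised
  separately over $y_j \in [-1,1]$ by the sign of $\langle a_j, x\rangle$.
\<close>
lemma sign_vertex_unique_maximizer:
  fixes A :: "real ^ 'm ^ 'n"
  assumes gen: "generic_direction A x" and z: "z \<in> zonotope A" "z \<noteq> A *v sign_vec (transpose A *v x)"
  shows "x \<bullet> z < x \<bullet> (A *v sign_vec (transpose A *v x))"
proof -
  define s where "s = sign_vec (transpose A *v x)"
  obtain y where y: "z = A *v y" "\<And>j. - 1 \<le> y $ j" "\<And>j. y $ j \<le> 1"
    using z(1) by (auto simp: zonotope_def)
  have inn: "x \<bullet> (A *v w) = (\<Sum>j\<in>UNIV. (column j A \<bullet> x) * w $ j)" for w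
    unfolding dot_lmul_matrix[symmetric]
    by (simp add: vector_matrix_mult_def inner_vec_def column_def mult.commute)
  have le: "(column j A \<bullet> x) * y $ j \<le> (column j A \<bullet> x) * s $ j" for j
  proof -
    have "s $ j = (if 0 \<le> column j A \<bullet> x then 1 else - 1)"
      unfolding s_def sign_vec_def by (simp only: vec_lambda_beta transpose_mult_nth)
    then show ?thesis
      using mult_left_mono[OF y(3)[of j], of "column j A \<bullet> x"]
        mult_left_mono_neg[OF y(2)[of j], of "column j A \<bullet> x"] by auto
  qed
  have "y \<noteq> s" using z(2) y(1) by (auto simp: s_def)
  then obtain j where j: "y $ j \<noteq> s $ j" by (auto simp: vec_eq_iff)
  have "(column j A \<bullet> x) * y $ j \<noteq> (column j A \<bullet> x) * s $ j"
    using gen j by (auto simp: generic_direction_def)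
  with le[of j] have "(column j A \<bullet> x) * y $ j < (column j A \<bullet> x) * s $ j" by linarith
  then have "x \<bullet> (A *v y) < x \<bullet> (A *v s)"
    unfolding inn using le by (intro sum_strict_mono_ex1) auto
  then show ?thesis by (simp add: y(1) s_def)
qed

lemma sign_vertex_in_vert:
  assumes "generic_direction A x"
  shows "A *v sign_vec (transpose A *v x) \<in> vert (zonotope A)"
  using sign_vertex_unique_maximizer[OF assms] sign_vertex_in_zonotope
  by (intro unique_maximizer_is_vertex[where x=x]) auto

section \<open>Removing antipodal pairs of vertices\<close>

definition centrally_symmetric :: "'a::uminus set \<Rightarrow> bool"
  where "centrally_symmetric S \<longleftrightarrow> (\<forall>v\<in>S. - v \<in> S)"

lemma centrally_symmetric_Diff: "centrally_symmetric S \<Longrightarrow> centrally_symmetric T \<Longrightarrow> centrally_symmetric (S - T)"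
  for S T :: "'a::group_add set"
  unfolding centrally_symmetric_def by (metis Diff_iff minus_minus)

lemma centrally_symmetric_insert_pair: "centrally_symmetric S \<Longrightarrow> centrally_symmetric (insert v (insert (- v) S))"
  for S :: "'a::group_add set"
  by (auto simp: centrally_symmetric_def)

lemma centrally_symmetric_Diff_singleton:
  fixes P :: "'a::group_add set"
  assumes "centrally_symmetric P"
  shows "P - {- v} = uminus ` (P - {v})"
proof (intro equalityI subsetI)
  show "x \<in> uminus ` (P - {v})" if "x \<in> P - {- v}" for x
    using that assms by (intro image_eqI[of _ _ "- x"]) (auto simp: centrally_symmetric_def)
qed (use assms in \<open>auto simp: centrally_symmetric_def\<close>)

lemma convex_hull_uminus_image:
  fixes S :: "'a::real_vector set"
  shows "convex hull (uminus ` S) = uminus ` (convex hull S)"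
  using convex_hull_linear_image[of uminus S] by (simp add: linear_uminus)
lemma zero_in_convex_hull_symmetric:
  fixes T :: "'a::real_vector set"
  assumes "centrally_symmetric T" "T \<noteq> {}"
  shows "0 \<in> convex hull T"
proof -
  obtain t where t: "t \<in> T" "- t \<in> T" using assms by (auto simp: centrally_symmetric_def)
  have "(1 / 2) *\<^sub>R t + (1 / 2) *\<^sub>R - t \<in> convex hull T"
    using t by (intro convexD convex_convex_hull hull_inc) auto
  then show ?thesis by simp
qed

text \<open>
  Deleting a vertex $v$ from a symmetric polytope also deletes $-v$. This costs no extra distance: if
  $y = -l v + (1-l) q$ with $q$ in the remaining hull, then shrinking $q$ towards the centre gives the
  point $z = \frac{1-l}{1+l} q$ of that hull, and $v - z = \frac{1}{1+l}(v - y)$.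
\<close>
lemma antipodal_point_removable:
  fixes v :: "'a::real_normed_vector"
  assumes T: "centrally_symmetric T" "T \<noteq> {}"
    and y: "y \<in> convex hull (insert (- v) T)" "norm (v - y) \<le> \<delta>"
  shows "\<exists>z\<in>convex hull T. norm (v - z) \<le> \<delta>"
proof -
  from y(1) obtain l r q where lr: "0 \<le> l" "0 \<le> r" "l + r = 1"
    and q: "q \<in> convex hull T" "y = l *\<^sub>R - v + r *\<^sub>R q"
    unfolding convex_hull_insert[OF T(2)] by auto
  define z where "z = (r / (1 + l)) *\<^sub>R q"
  have "(1 - r / (1 + l)) *\<^sub>R 0 + (r / (1 + l)) *\<^sub>R q \<in> convex hull T"
  proof (intro convexD convex_convex_hull)
    have "r / (1 + l) \<le> 1" using lr by (subst pos_divide_le_eq) auto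
    then show "0 \<le> 1 - r / (1 + l)" by simp
  qed (use lr q zero_in_convex_hull_symmetric[OF T] in auto)
  then have z: "z \<in> convex hull T" by (simp add: z_def)
  have "(1 + l) *\<^sub>R z = r *\<^sub>R q" using lr by (simp add: z_def)
  then have "(1 + l) *\<^sub>R (v - z) = v - y"
    by (simp add: q(2) algebra_simps)
  then have "(1 + l) * norm (v - z) \<le> \<delta>"
    using y(2) lr by (metis abs_of_nonneg add_nonneg_nonneg norm_scaleR zero_le_one)
  moreover have "norm (v - z) \<le> (1 + l) * norm (v - z)"
    using lr by (simp add: distrib_right)
  ultimately show ?thesis using z by force
qed

lemma convex_near_convex_hull:
  fixes T :: "'a::real_normed_vector set"
  shows "convex {y. \<exists>z\<in>convex hull T. norm (y - z) \<le> \<delta>}"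
proof -
  have "{y. \<exists>z\<in>convex hull T. norm (y - z) \<le> \<delta>} = (\<Union>x\<in>convex hull T. \<Union>y\<in>cball 0 \<delta>. {x + y})"
  proof (intro equalityI subsetI)
    fix y assume "y \<in> {y. \<exists>z\<in>convex hull T. norm (y - z) \<le> \<delta>}"
    then obtain z where z: "z \<in> convex hull T" "y - z \<in> cball 0 \<delta>" by auto
    have "y = z + (y - z)" by simp
    then show "y \<in> (\<Union>x\<in>convex hull T. \<Union>y\<in>cball 0 \<delta>. {x + y})" using z by blast
  qed (auto, metis add_diff_cancel_left')
  then show ?thesis by (simp add: convex_sums convex_convex_hull)
qed

text \<open>
  The points within distance $\delta$ of the smaller hull form a convex set, so it is enough that this
  set contains the two deleted vertices.
\<close>
lemma convex_hull_remove_pair: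
  fixes v :: "'a::real_normed_vector"
  assumes T: "centrally_symmetric T" "T \<noteq> {}" and \<delta>: "\<delta> \<ge> 0"
    and y: "y \<in> convex hull (insert (- v) T)" "norm (v - y) \<le> \<delta>"
    and x: "x \<in> convex hull (insert v (insert (- v) T))"
  shows "\<exists>z\<in>convex hull T. norm (x - z) \<le> \<delta>"
proof -
  obtain z where z: "z \<in> convex hull T" "norm (v - z) \<le> \<delta>"
    using antipodal_point_removable[OF T y] by auto
  have "uminus ` T = T"
    using T(1) by (force simp: centrally_symmetric_def image_iff intro: minus_minus[symmetric])
  then have "uminus ` (convex hull T) = convex hull T"
    by (simp flip: convex_hull_uminus_image)
  then have z': "- z \<in> convex hull T" using z(1) by blast
  have "insert v (insert (- v) T) \<subseteq> {y. \<exists>z\<in>convex hull T. norm (y - z) \<le> \<delta>}"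
  proof (intro insert_subsetI subsetI)
    show "v \<in> {y. \<exists>z\<in>convex hull T. norm (y - z) \<le> \<delta>}" using z by auto
    have "norm (- v - - z) \<le> \<delta>" using z(2) by (simp add: norm_minus_commute)
    then show "- v \<in> {y. \<exists>z\<in>convex hull T. norm (y - z) \<le> \<delta>}" using z' by blast
    show "t \<in> {y. \<exists>z\<in>convex hull T. norm (y - z) \<le> \<delta>}" if "t \<in> T" for t
      using that \<delta> hull_inc[of t T] by force
  qed
  then have "convex hull (insert v (insert (- v) T)) \<subseteq> {y. \<exists>z\<in>convex hull T. norm (y - z) \<le> \<delta>}"
    by (rule hull_minimal) (rule convex_near_convex_hull)
  then show ?thesis using x by auto
qed

lemma hausdorff_distance_le:
  fixes S T :: "'a::real_normed_vector set"
  assumes "T \<subseteq> S" "T \<noteq> {}" and near: "\<And>y. y \<in> S \<Longrightarrow> \<exists>z\<in>T. norm (y - z) \<le> c"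
  shows "hausdorff_distance S T \<le> c"
proof -
  have "(SUP x\<in>S. infdist x T) \<le> c"
  proof (rule cSUP_least)
    show "S \<noteq> {}" using assms by auto
    fix y assume "y \<in> S"
    then obtain z where "z \<in> T" "norm (y - z) \<le> c" using near by blast
    then show "infdist y T \<le> c" using infdist_le2[of z T y c] by (simp add: dist_norm)
  qed
  moreover have "(SUP y\<in>T. infdist y S) \<le> c"
  proof (rule cSUP_least[OF assms(2)])
    fix y assume y: "y \<in> T"
    then obtain z where "norm (y - z) \<le> c" using near[of y] assms(1) by auto
    then have "0 \<le> c" using norm_ge_zero[of "y - z"] by linarith
    then show "infdist y S \<le> c" using y assms(1) by auto
  qed
  ultimately show ?thesis by (simp add: hausdorff_distance_def)
qed

text \<open>
  Delete from $P$ pairs $\pm v$ of vertices missing from $V$, one pair at a time, as long as some missing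
  $v$ lies closer than $\delta$ to the hull of the other remaining points; each pair moves the hull by at
  most $\delta$. Such a $v$ is closer than $\delta$ to the hull of the larger set $P - \{v\}$ too, so no point
  of $U$ is ever deleted. The last hypothesis says that the process never gets stuck, so it ends with
  $V$ after half as many steps as there are missing points. The proof takes a maximal set $S$ of
  points that may be deleted.
\<close>
lemma hausdorff_distance_missing_vertices:
  fixes P U V :: "'a::real_normed_vector set"
  assumes P: "finite P" "centrally_symmetric P" "0 \<notin> P"
    and V: "V \<subseteq> P" "centrally_symmetric V" "V \<noteq> {}"
    and \<delta>: "\<delta> \<ge> 0"
    and U: "\<And>v. v \<in> U \<Longrightarrow> v \<in> P \<Longrightarrow> \<forall>y\<in>convex hull (P - {v}). \<delta> \<le> norm (v - y)"
    and removable: "\<And>S v. S \<subseteq> P - U \<Longrightarrow> centrally_symmetric S \<Longrightarrow> v \<in> P - S \<Longrightarrow>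
      insert v (insert (- v) S) \<inter> V = {} \<Longrightarrow> \<exists>y\<in>convex hull (P - S - {v}). norm (v - y) < \<delta>"
  shows "hausdorff_distance (convex hull P) (convex hull V) \<le> real (card (P - V)) / 2 * \<delta>"
proof -
  define good where "good S \<longleftrightarrow> S \<subseteq> P - V \<and> S \<subseteq> P - U \<and> centrally_symmetric S \<and>
    (\<forall>x\<in>convex hull P. \<exists>z\<in>convex hull (P - S). norm (x - z) \<le> real (card S) / 2 * \<delta>)" for S
  have "good {}" by (auto simp: good_def centrally_symmetric_def)
  moreover have "finite {S. good S}"
    by (rule finite_subset[of _ "Pow P"]) (auto simp: good_def P)
  ultimately obtain S where S: "good S" and max: "\<And>S'. good S' \<Longrightarrow> S \<subseteq> S' \<Longrightarrow> S = S'"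
    using finite_has_maximal[of "{S. good S}"] by auto
  have "S = P - V"
  proof (rule ccontr)
    assume "S \<noteq> P - V"
    then obtain v where v: "v \<in> P" "v \<notin> V" "v \<notin> S" using S by (auto simp: good_def)
    have nv: "- v \<in> P" "- v \<notin> V" "- v \<notin> S"
      using v P(2) V(2) S by (auto simp: good_def centrally_symmetric_def)
    have ne: "v \<noteq> - v" using v P(3) by (intro neq_uminus) auto
    define S' where "S' = insert v (insert (- v) S)"
    define T where "T = P - S'"
    have S_sub: "S \<subseteq> P" "S \<inter> V = {}" "centrally_symmetric S" using S by (auto simp: good_def)
    have T: "centrally_symmetric T" "T \<noteq> {}" "P - S = insert v (insert (- v) T)"
    proof -
      show "centrally_symmetric T" unfolding T_def S'_def by (intro centrally_symmetric_Diff centrally_symmetric_insert_pair P(2) S_sub(3))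
      show "T \<noteq> {}" using V v nv S_sub unfolding T_def S'_def by fast
      show "P - S = insert v (insert (- v) T)" using v nv unfolding T_def S'_def by blast
    qed
    have "v \<notin> insert (- v) T" using ne by (auto simp: T_def S'_def)
    then have "P - S - {v} = insert (- v) T" unfolding T(3) by blast
    moreover have "\<exists>y\<in>convex hull (P - S - {v}). norm (v - y) < \<delta>"
      using S v nv by (intro removable) (auto simp: good_def)
    ultimately obtain y where y: "y \<in> convex hull (insert (- v) T)" "y \<in> convex hull (P - S - {v})" "norm (v - y) < \<delta>"
      by auto
    have "y \<in> convex hull (P - {v})"
      using y(2) hull_mono[of "P - S - {v}" "P - {v}" convex] by auto
    then have "v \<notin> U" using U[of v] v y(3) by force
    moreover have "- v \<notin> U"
    proof
      assume "- v \<in> U"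
      moreover have "- y \<in> convex hull (P - {- v})"
      proof -
        have "convex hull (P - {- v}) = uminus ` (convex hull (P - {v}))"
          by (simp add: centrally_symmetric_Diff_singleton[OF P(2)] convex_hull_uminus_image)
        then show ?thesis using \<open>y \<in> convex hull (P - {v})\<close> by auto
      qed
      ultimately have "\<delta> \<le> norm (- v - - y)" using U[of "- v"] nv by blast
      then show False using y(3) by (simp add: norm_minus_commute)
    qed
    ultimately have "S' \<subseteq> P - U" "S' \<subseteq> P - V" "centrally_symmetric S'"
      using S v nv by (auto simp: S'_def good_def intro!: centrally_symmetric_insert_pair)
    moreover have "\<exists>z\<in>convex hull (P - S'). norm (x - z) \<le> real (card S') / 2 * \<delta>" if x: "x \<in> convex hull P" for x
    proof -
      obtain x' where x': "x' \<in> convex hull (P - S)" "norm (x - x') \<le> real (card S) / 2 * \<delta>"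
        using S x by (auto simp: good_def)
      obtain z where z: "z \<in> convex hull T" "norm (x' - z) \<le> \<delta>"
        using convex_hull_remove_pair[OF T(1,2) \<delta> y(1) less_imp_le[OF y(3)], of x'] x'(1) T(3) by auto
      have "finite S" using S_sub P(1) finite_subset by blast
      then have "card S' = card S + 2"
        using v nv ne by (simp add: S'_def)
      moreover have "norm (x - z) \<le> norm (x - x') + norm (x' - z)"
        using norm_triangle_ineq[of "x - x'" "x' - z"] by simp
      ultimately have "norm (x - z) \<le> real (card S') / 2 * \<delta>"
        using x'(2) z(2) by (simp add: algebra_simps add_divide_distrib)
      then show ?thesis using z(1) by (auto simp: T_def)
    qed
    ultimately have "good S'" by (simp add: good_def)
    moreover have "S \<subseteq> S'" "v \<in> S'" by (auto simp: S'_def)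
    ultimately show False using max[of S'] v(3) by blast
  qed
  then have "P - S = V" using V(1) by blast
  show ?thesis
  proof (rule hausdorff_distance_le)
    show "convex hull V \<subseteq> convex hull P" using V(1) by (rule hull_mono)
    show "convex hull V \<noteq> {}" using V(3) by simp
    fix x assume "x \<in> convex hull P"
    then show "\<exists>z\<in>convex hull V. norm (x - z) \<le> real (card (P - V)) / 2 * \<delta>"
      using S \<open>P - S = V\<close> \<open>S = P - V\<close> unfolding good_def by metis
  qed
qed

text \<open>
  Let $u$ be the unit vector from the point of $\operatorname{conv}(Q)$ nearest to $v$ towards $v$. Every
  difference $v - w$ has length at most $b$ and component at least $\delta$ along $u$, so it makes an angle of
  at most $\arccos(\delta/b)$ with $u$. A direction whose slope away from $u$ is at most $\delta/b$ therefore has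
  a nonnegative product with all these differences; the opposite directions have a nonpositive one.
\<close>
lemma separated_vertex_double_cone:
  fixes v :: "'a::euclidean_space"
  assumes Q: "finite Q" "Q \<noteq> {}" and \<delta>: "\<delta> > 0"
    and far: "\<And>y. y \<in> convex hull Q \<Longrightarrow> \<delta> \<le> norm (v - y)"
    and b: "\<And>w. w \<in> Q \<Longrightarrow> norm (v - w) \<le> b"
  obtains u where "norm u = 1"
    and "\<And>x. x \<in> double_cone (\<delta> / b) u \<Longrightarrow>
      (\<forall>w\<in>Q. x \<bullet> w \<le> x \<bullet> v) \<or> (\<forall>w\<in>Q. x \<bullet> v \<le> x \<bullet> w)"
proof -
  have cmp: "compact (convex hull Q)" using Q by (simp add: finite_imp_compact_convex_hull)
  then obtain y where y: "y \<in> convex hull Q" "\<And>z. z \<in> convex hull Q \<Longrightarrow> dist v y \<le> dist v z"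
    using distance_attains_inf[of "convex hull Q" v] Q compact_imp_closed by auto
  define d where "d = norm (v - y)"
  define u where "u = (1 / d) *\<^sub>R (v - y)"
  have d: "d \<ge> \<delta>" using far[OF y(1)] by (simp add: d_def)
  have vy: "v - y = d *\<^sub>R u" using d \<delta> by (simp add: u_def)
  have "\<bar>1 / d\<bar> * d = 1" using d \<delta> by simp
  then have u: "norm u = 1" unfolding u_def norm_scaleR d_def .
  have uu: "u \<bullet> u = 1" using u by (simp add: norm_eq_1)
  have sep: "\<delta> \<le> u \<bullet> (v - w)" if w: "w \<in> Q" for w
  proof -
    have "(v - y) \<bullet> (w - y) \<le> 0"
      using cmp y w by (intro any_closest_point_dot[of "convex hull Q"]) (auto intro: compact_imp_closed hull_inc)
    then have "d * (u \<bullet> (w - y)) \<le> 0" unfolding vy by simp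
    then have "u \<bullet> (w - y) \<le> 0" using d \<delta> by (simp add: mult_le_0_iff)
    moreover have "u \<bullet> (v - y) = d" unfolding vy by (simp add: uu)
    ultimately show ?thesis using d by (simp add: inner_diff_right)
  qed
  obtain w0 where w0: "w0 \<in> Q" using Q by auto
  have "\<delta> \<le> norm (v - w0)" using far hull_inc[OF w0, of convex] by auto
  then have b0: "b > 0" using b[OF w0] \<delta> by linarith
  have pos: "x \<bullet> w \<le> x \<bullet> v" if x: "x \<in> double_cone (\<delta> / b) u" "x \<bullet> u \<ge> 0" and w: "w \<in> Q" for x w
  proof -
    define y where "y = x - (x \<bullet> u) *\<^sub>R u"
    have ny: "norm y \<le> \<delta> / b * (x \<bullet> u)" using x by (simp add: double_cone_def y_def)
    have "y \<bullet> u = 0" by (simp add: y_def inner_diff_left uu)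
    have "\<bar>y \<bullet> (v - w)\<bar> \<le> norm y * norm (v - w)" by (rule Cauchy_Schwarz_ineq2)
    also have "\<dots> \<le> (\<delta> / b * (x \<bullet> u)) * b"
      using ny b[OF w] x(2) \<delta> b0 by (intro mult_mono) auto
    also have "\<dots> = \<delta> * (x \<bullet> u)" using b0 by simp
    finally have "- (\<delta> * (x \<bullet> u)) \<le> y \<bullet> (v - w)" by linarith
    moreover have "(x \<bullet> u) * \<delta> \<le> (x \<bullet> u) * (u \<bullet> (v - w))"
      using sep[OF w] x(2) by (intro mult_left_mono)
    moreover have "x \<bullet> (v - w) = y \<bullet> (v - w) + (x \<bullet> u) * (u \<bullet> (v - w))"
      by (simp add: y_def inner_diff_left)
    ultimately have "0 \<le> x \<bullet> (v - w)" by (simp add: mult.commute)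
    then show ?thesis by (simp add: inner_diff_right)
  qed
  show ?thesis
  proof (rule that[OF u])
    fix x assume x: "x \<in> double_cone (\<delta> / b) u"
    show "(\<forall>w\<in>Q. x \<bullet> w \<le> x \<bullet> v) \<or> (\<forall>w\<in>Q. x \<bullet> v \<le> x \<bullet> w)"
    proof (cases "x \<bullet> u \<ge> 0")
      case True
      then show ?thesis using pos[OF x] by auto
    next
      case False
      have "- x - (- x \<bullet> u) *\<^sub>R u = - (x - (x \<bullet> u) *\<^sub>R u)" by (simp add: algebra_simps)
      then have "norm (- x - (- x \<bullet> u) *\<^sub>R u) = norm (x - (x \<bullet> u) *\<^sub>R u)"
        by (simp only: norm_minus_cancel)
      then have "- x \<in> double_cone (\<delta> / b) u" using x by (simp add: double_cone_def)
      then show ?thesis using pos[of "- x"] False by auto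
    qed
  qed
qed

text \<open>
  A symmetric subset is a choice among the pairs $\pm v$.
\<close>
lemma card_symmetric_subsets:
  fixes T :: "'a::real_vector set"
  assumes "finite T" "centrally_symmetric T" "0 \<notin> T"
  shows "real (card {S. S \<subseteq> T \<and> centrally_symmetric S}) \<le> 2 powr (real (card T) / 2)"
  using assms
proof (induction "card T" arbitrary: T rule: less_induct)
  case less
  show ?case
  proof (cases "T = {}")
    case True
    then have "{S. S \<subseteq> T \<and> centrally_symmetric S} = {{}}" by (auto simp: centrally_symmetric_def)
    then show ?thesis using True by simp
  next
    case False
    then obtain v where v: "v \<in> T" "- v \<in> T" using less.prems by (auto simp: centrally_symmetric_def)
    have ne: "v \<noteq> - v" using v less.prems by (intro neq_uminus) auto
    define T' where "T' = T - {v, - v}"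
    have T: "T = insert v (insert (- v) T')" "v \<notin> insert (- v) T'" "- v \<notin> T'"
      using v ne by (auto simp: T'_def)
    have fin: "finite T'" using less.prems by (simp add: T'_def)
    have card: "card T = card T' + 2" using fin T(2,3) by (subst T(1)) simp
    have "centrally_symmetric {v, - v}" by (auto simp: centrally_symmetric_def)
    then have "centrally_symmetric T'" using less.prems unfolding T'_def by (intro centrally_symmetric_Diff)
    then have IH: "real (card {S. S \<subseteq> T' \<and> centrally_symmetric S}) \<le> 2 powr (real (card T') / 2)"
      using less.prems fin card by (intro less.hyps) (auto simp: T'_def)
    let ?f = "\<lambda>S. (S - {v, - v}, v \<in> S)"
    have "inj_on ?f {S. S \<subseteq> T \<and> centrally_symmetric S}"
    proof (rule inj_onI)
      fix R S assume RS: "R \<in> {S. S \<subseteq> T \<and> centrally_symmetric S}" "S \<in> {S. S \<subseteq> T \<and> centrally_symmetric S}" "?f R = ?f S"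
      have "- v \<in> R \<longleftrightarrow> v \<in> R" "- v \<in> S \<longleftrightarrow> v \<in> S"
        using RS(1,2) by (auto simp: centrally_symmetric_def)
      then show "R = S" using RS(3) by auto
    qed
    moreover have "?f ` {S. S \<subseteq> T \<and> centrally_symmetric S} \<subseteq> {S. S \<subseteq> T' \<and> centrally_symmetric S} \<times> UNIV"
      using \<open>centrally_symmetric {v, - v}\<close> by (auto simp: T'_def intro: centrally_symmetric_Diff)
    ultimately have "card {S. S \<subseteq> T \<and> centrally_symmetric S} \<le> card ({S. S \<subseteq> T' \<and> centrally_symmetric S} \<times> (UNIV :: bool set))"
      using fin by (intro card_inj_on_le) auto
    also have "\<dots> = 2 * card {S. S \<subseteq> T' \<and> centrally_symmetric S}"
      by (simp add: card_cartesian_product)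
    finally have "real (card {S. S \<subseteq> T \<and> centrally_symmetric S}) \<le> 2 * real (card {S. S \<subseteq> T' \<and> centrally_symmetric S})"
      by linarith
    also have "\<dots> \<le> 2 * 2 powr (real (card T') / 2)" using IH by simp
    also have "\<dots> = 2 powr (real (card T) / 2)"
      by (simp add: card add_divide_distrib powr_add)
    finally show ?thesis .
  qed
qed

section \<open>Vertices found by generic samples\<close>

definition sign_vertex :: "real ^ 'm ^ 'n \<Rightarrow> real ^ 'n \<Rightarrow> real ^ 'n"
  where "sign_vertex A x = A *v sign_vec (transpose A *v x)"

lemma centrally_symmetric_vert_zonotope: "centrally_symmetric (vert (zonotope A))"
  using uminus_vert uminus_zonotope unfolding centrally_symmetric_def by blast

lemma vertex_enum_generic:
  assumes "\<And>i. i < q \<Longrightarrow> generic_direction A (x i)"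
  shows "vertex_enum A x q \<subseteq> vert (zonotope A) \<and> centrally_symmetric (vertex_enum A x q) \<and>
    (\<forall>i<q. sign_vertex A (x i) \<in> vertex_enum A x q)"
  using assms
proof (induction q)
  case 0
  then show ?case by (simp add: centrally_symmetric_def)
next
  case (Suc q)
  let ?V = "vertex_enum A x q" and ?v = "sign_vertex A (x q)"
  have IH: "?V \<subseteq> vert (zonotope A)" "centrally_symmetric ?V" "\<And>i. i < q \<Longrightarrow> sign_vertex A (x i) \<in> ?V"
    using Suc by auto
  have v: "?v \<in> vert (zonotope A)" "- ?v \<in> vert (zonotope A)"
    using sign_vertex_in_vert[OF Suc.prems[of q]] centrally_symmetric_vert_zonotope[of A]
    by (auto simp: sign_vertex_def centrally_symmetric_def)
  show ?case
  proof (cases "vert (zonotope A) \<subseteq> ?V")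
    case True
    then show ?thesis using IH v by (auto simp: less_Suc_eq)
  next
    case False
    then have "vertex_enum A x (Suc q) = (if ?v \<notin> ?V then ?V \<union> {?v, - ?v} else ?V)"
      by (simp add: enum_step_def sign_vertex_def Let_def)
    then show ?thesis
      using IH v by (auto simp: less_Suc_eq centrally_symmetric_def)
  qed
qed

text \<open>
  If $v$ maximises a generic $x$ over the vertices outside $S$, then the maximiser over all vertices is
  $v$ or a point of $S$. If $v$ minimises $x$ there, the same holds for $-v$ by symmetry.
\<close>
lemma sign_vertex_hit:
  fixes A :: "real ^ 'm ^ 'n"
  assumes gen: "generic_direction A x" and S: "centrally_symmetric S"
    and max: "(\<forall>w\<in>vert (zonotope A) - S - {v}. x \<bullet> w \<le> x \<bullet> v) \<or> (\<forall>w\<in>vert (zonotope A) - S - {v}. x \<bullet> v \<le> x \<bullet> w)"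
    and v: "v \<in> vert (zonotope A)"
  shows "sign_vertex A x \<in> insert v (insert (- v) S)"
proof (rule ccontr)
  let ?g = "sign_vertex A x"
  assume not_in: "?g \<notin> insert v (insert (- v) S)"
  have g: "?g \<in> vert (zonotope A)" using sign_vertex_in_vert[OF gen] by (simp add: sign_vertex_def)
  have strict: "x \<bullet> z < x \<bullet> ?g" if "z \<in> vert (zonotope A)" "z \<noteq> ?g" for z
    using sign_vertex_unique_maximizer[OF gen, of z] that vert_subset by (auto simp: sign_vertex_def)
  have neg: "- ?g \<in> vert (zonotope A)" "- v \<in> vert (zonotope A)"
    using g v centrally_symmetric_vert_zonotope by (auto simp: centrally_symmetric_def)
  from max show False
  proof
    assume "\<forall>w\<in>vert (zonotope A) - S - {v}. x \<bullet> w \<le> x \<bullet> v"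
    then have "x \<bullet> ?g \<le> x \<bullet> v" using g not_in by blast
    then show False using strict[OF v] not_in by force
  next
    assume a: "\<forall>w\<in>vert (zonotope A) - S - {v}. x \<bullet> v \<le> x \<bullet> w"
    have "- ?g \<notin> S" "- ?g \<noteq> v" using not_in S unfolding centrally_symmetric_def by force+
    then have "x \<bullet> v \<le> x \<bullet> - ?g" using a neg by blast
    then have "x \<bullet> ?g \<le> x \<bullet> - v" by simp
    then show False using strict[OF neg(2)] not_in by force
  qed
qed

text \<open>
  One step of the algorithm depends on the sample only through the set $J$ of indices where $A^T x$ is
  nonnegative, which has finitely many values.
\<close>
lemma measurable_vertex_enum:
  fixes A :: "real ^ 'm ^ 'n" and X :: "nat \<Rightarrow> 'w \<Rightarrow> real ^ 'n"
  assumes "\<And>i. i < q \<Longrightarrow> X i \<in> borel_measurable M"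
  shows "{\<omega>\<in>space M. P (vertex_enum A (\<lambda>i. X i \<omega>) q)} \<in> sets M"
  using assms
proof (induction q arbitrary: P)
  case 0
  then show ?case by simp
next
  case (Suc q)
  define F :: "'m set \<Rightarrow> (real ^ 'n) set \<Rightarrow> (real ^ 'n) set" where
    "F J V = (if vert (zonotope A) \<subseteq> V then V
      else let v = A *v (\<chi> j. if j \<in> J then 1 else - 1) in if v \<notin> V then V \<union> {v, - v} else V)" for J V
  have X [measurable]: "X q \<in> borel_measurable M" using Suc.prems by simp
  have step: "vertex_enum A (\<lambda>i. X i \<omega>) (Suc q) = F {j. 0 \<le> column j A \<bullet> X q \<omega>} (vertex_enum A (\<lambda>i. X i \<omega>) q)" for \<omega>
  proof -
    have "sign_vec (transpose A *v X q \<omega>) = (\<chi> j. if j \<in> {j. 0 \<le> column j A \<bullet> X q \<omega>} then 1 else - 1)"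
      unfolding sign_vec_def by (simp only: transpose_mult_nth mem_Collect_eq)
    then show ?thesis by (simp add: F_def enum_step_def Let_def)
  qed
  have "{\<omega>\<in>space M. P (vertex_enum A (\<lambda>i. X i \<omega>) (Suc q))} =
    (\<Union>J\<in>UNIV. {\<omega>\<in>space M. \<forall>j\<in>UNIV. (0 \<le> column j A \<bullet> X q \<omega>) = (j \<in> J)} \<inter>
      {\<omega>\<in>space M. P (F J (vertex_enum A (\<lambda>i. X i \<omega>) q))})"
    unfolding step by (auto cong: rev_conj_cong)
  also have "\<dots> \<in> sets M"
  proof (intro sets.finite_UN sets.Int)
    fix J :: "'m set"
    show "{\<omega>\<in>space M. \<forall>j\<in>UNIV. (0 \<le> column j A \<bullet> X q \<omega>) = (j \<in> J)} \<in> sets M"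
      by measurable
    show "{\<omega>\<in>space M. P (F J (vertex_enum A (\<lambda>i. X i \<omega>) q))} \<in> sets M"
      using Suc.prems by (intro Suc.IH) auto
  qed simp
  finally show ?case .
qed

lemma AE_generic_direction:
  fixes A :: "real ^ 'm ^ 'n"
  assumes "\<And>j. column j A \<noteq> 0"
  shows "AE x in lborel. generic_direction A x"
proof -
  have "AE x in lborel. column j A \<bullet> x \<noteq> 0" for j
    using assms by (rule AE_inner_nonzero)
  then have "AE x in lborel. \<forall>j\<in>UNIV. column j A \<bullet> x \<noteq> 0"
    by (intro AE_finite_allI) auto
  then show ?thesis by (simp add: generic_direction_def)
qed

text \<open>
  The deterministic half of the theorem. Suppose $v$ still has distance at least $\delta$ from the other
  vertices once $S$ is deleted. A sample that is maximised or minimised at $v$ over the vertices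
  outside $S$ puts a point of $S \cup \{\pm v\}$ into $V$, so $S \cup \{\pm v\}$ cannot be entirely missing,
  and the deletion process above never gets stuck.
\<close>
lemma enumeration_success:
  fixes A :: "real ^ 'm ^ 'n"
  defines "Z \<equiv> zonotope A" and "V x q \<equiv> vertex_enum A x q"
  assumes cols: "\<And>j. column j A \<noteq> 0"
    and \<delta>: "\<delta> > 0"
    and U: "U = {v \<in> vert Z. simplicial_constant Z v \<ge> \<delta>}"
    and gen: "\<And>i. i < q \<Longrightarrow> generic_direction A (x i)" and q: "q > 0"
    and hit: "\<And>S v. S \<subseteq> vert Z - U \<Longrightarrow> centrally_symmetric S \<Longrightarrow> v \<in> vert Z - S \<Longrightarrow>
      \<forall>y\<in>convex hull (vert Z - S - {v}). \<delta> \<le> norm (v - y) \<Longrightarrow>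
      \<exists>i<q. (\<forall>w\<in>vert Z - S - {v}. x i \<bullet> w \<le> x i \<bullet> v) \<or> (\<forall>w\<in>vert Z - S - {v}. x i \<bullet> v \<le> x i \<bullet> w)"
  shows "hausdorff_distance Z (convex hull (V x q)) \<le> real (card (vert Z - V x q)) / 2 * \<delta>"
proof -
  have V: "V x q \<subseteq> vert Z" "centrally_symmetric (V x q)" "\<And>i. i < q \<Longrightarrow> sign_vertex A (x i) \<in> V x q"
    using vertex_enum_generic[of q A x] gen by (auto simp: V_def Z_def)
  have "hausdorff_distance (convex hull (vert Z)) (convex hull (V x q)) \<le> real (card (vert Z - V x q)) / 2 * \<delta>"
  proof (rule hausdorff_distance_missing_vertices[where U=U])
    show "finite (vert Z)" "centrally_symmetric (vert Z)" "0 \<notin> vert Z"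
      using finite_vert_zonotope centrally_symmetric_vert_zonotope zero_notin_vert_zonotope[OF cols]
      by (auto simp: Z_def)
    show "V x q \<noteq> {}" using V(3)[OF q] by auto
    show "\<forall>y\<in>convex hull (vert Z - {v}). \<delta> \<le> norm (v - y)" if "v \<in> U" for v
    proof
      fix y assume "y \<in> convex hull (vert Z - {v})"
      then have "simplicial_constant Z v \<le> norm (v - y)"
        unfolding simplicial_constant_def by (intro cINF_lower bdd_belowI2[of _ 0]) auto
      then show "\<delta> \<le> norm (v - y)" using that U by auto
    qed
    fix S v assume S: "S \<subseteq> vert Z - U" "centrally_symmetric S" "v \<in> vert Z - S"
      and disj: "insert v (insert (- v) S) \<inter> V x q = {}"
    show "\<exists>y\<in>convex hull (vert Z - S - {v}). norm (v - y) < \<delta>"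
    proof (rule ccontr)
      assume "\<not> ?thesis"
      then have "\<forall>y\<in>convex hull (vert Z - S - {v}). \<delta> \<le> norm (v - y)" by (simp add: not_less)
      from hit[OF S this] obtain i where i: "i < q"
        "(\<forall>w\<in>vert Z - S - {v}. x i \<bullet> w \<le> x i \<bullet> v) \<or> (\<forall>w\<in>vert Z - S - {v}. x i \<bullet> v \<le> x i \<bullet> w)"
        by auto
      then have "sign_vertex A (x i) \<in> insert v (insert (- v) S)"
        using S by (intro sign_vertex_hit gen) (auto simp: Z_def)
      then show False using disj V(3)[OF i(1)] by auto
    qed
  qed (use V \<delta> in auto)
  then show ?thesis by (simp add: Z_def convex_hull_vert_zonotope)
qed

lemma (in prob_space) prob_gaussian_samples_miss_cone:
  fixes X :: "nat \<Rightarrow> 'a \<Rightarrow> real ^ 'n"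
  assumes indep: "indep_vars (\<lambda>_. borel) X {..<p}" and p: "p > 0"
    and X: "\<And>i. i < p \<Longrightarrow> distributed M lborel (X i) (\<lambda>x. ennreal (std_gaussian_density x))"
    and u: "norm u = 1" and \<tau>: "\<tau> > 0"
  defines "k \<equiv> (1 / 2 * (1 - 1 / sqrt (1 + \<tau>\<^sup>2))) powr ((real CARD('n) - 1) / 2)"
  shows "prob {\<omega>\<in>space M. \<forall>i<p. X i \<omega> \<notin> double_cone \<tau> u} \<le> (1 - k) ^ p"
proof -
  let ?C = "double_cone \<tau> u"
  have C [measurable]: "?C \<in> sets borel" by (intro borel_closed closed_double_cone)
  have miss: "prob (X i -` (- ?C) \<inter> space M) \<le> 1 - k" if i: "i < p" for i
  proof -
    have Xi [measurable]: "X i \<in> borel_measurable M"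
      using distributed_measurable[OF X[OF i]] by simp
    have eq: "density lborel (\<lambda>x. ennreal (std_gaussian_density x)) = distr M lborel (X i)"
      using distributed_distr_eq_density[OF X[OF i]] by simp
    have "ennreal k * emeasure (distr M lborel (X i)) UNIV \<le> emeasure (distr M lborel (X i)) ?C"
      using double_cone_gaussian_bound[OF u \<tau>] unfolding k_def eq .
    then have "ennreal k \<le> emeasure M (X i -` ?C \<inter> space M)"
      by (simp add: emeasure_distr emeasure_space_1)
    then have k: "k \<le> prob (X i -` ?C \<inter> space M)"
      by (simp add: emeasure_eq_measure)
    have "X i -` (- ?C) \<inter> space M = space M - (X i -` ?C \<inter> space M)" by auto
    then show ?thesis
      using k by (simp add: prob_compl)
  qed
  have "{\<omega>\<in>space M. \<forall>i<p. X i \<omega> \<notin> ?C} = (\<Inter>i\<in>{..<p}. X i -` (- ?C) \<inter> space M)"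
    using p by blast
  moreover have "prob (\<Inter>i\<in>{..<p}. X i -` (- ?C) \<inter> space M) = (\<Prod>i\<in>{..<p}. prob (X i -` (- ?C) \<inter> space M))"
    by (rule indep_varsD_finite[OF indep]) (use p in auto)
  ultimately have "prob {\<omega>\<in>space M. \<forall>i<p. X i \<omega> \<notin> ?C} = (\<Prod>i\<in>{..<p}. prob (X i -` (- ?C) \<inter> space M))"
    by (simp only:)
  also have "\<dots> \<le> (\<Prod>i\<in>{..<p}. 1 - k)"
    using miss by (intro prod_mono) auto
  finally show ?thesis by simp
qed

section \<open>Probability of failure\<close>

lemma simplicial_constant_uminus:
  assumes "centrally_symmetric (vert S)"
  shows "simplicial_constant S (- v) = simplicial_constant S v"
proof -
  have "convex hull (vert S - {- v}) = uminus ` (convex hull (vert S - {v}))"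
    by (simp add: centrally_symmetric_Diff_singleton[OF assms] convex_hull_uminus_image)
  moreover have "norm (- v - - x) = norm (v - x)" for x
    by (simp add: norm_minus_commute)
  ultimately show ?thesis
    unfolding simplicial_constant_def by (simp only: image_image)
qed

text \<open>
  The complement of the angle with tangent $b/\delta$ is the opening angle of the cone of slope
  $\delta/b$, which connects the constant $k$ with the cone estimate.
\<close>
lemma sin_arctan_eq_cos_reciprocal:
  fixes b \<delta> :: real
  assumes "b > 0" "\<delta> > 0"
  shows "sin (arctan (b / \<delta>)) = 1 / sqrt (1 + (\<delta> / b)\<^sup>2)"
proof -
  have "1 + (b / \<delta>)\<^sup>2 = (b / \<delta>)\<^sup>2 * (1 + (\<delta> / b)\<^sup>2)"
    using assms by (simp add: field_simps)
  then have "sqrt (1 + (b / \<delta>)\<^sup>2) = b / \<delta> * sqrt (1 + (\<delta> / b)\<^sup>2)"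
    using assms by (simp add: real_sqrt_mult)
  then show ?thesis using assms by (simp add: sin_arctan)
qed

lemma miss_probability_small:
  fixes k \<epsilon> N :: real
  assumes k: "0 < k" "k \<le> 1" and \<epsilon>: "\<epsilon> > 0" and N: "N > 0" and p: "p > 0"
    and large: "real p > ln (N / \<epsilon>) / ln (1 / (1 - k))"
  shows "(1 - k) ^ p \<le> \<epsilon> / N"
\<comment> \<open>For $k = 1$, which is the case of dimension one, the quotient of logarithms is $0$ by the convention on division, and a single sample suffices.\<close>
proof (cases "k = 1")
  case True
  then show ?thesis using \<epsilon> N p by (simp add: zero_power)
next
  case False
  then have k1: "0 < 1 - k" "1 - k < 1" using k by auto
  then have "ln (1 / (1 - k)) > 0" by (intro ln_gt_zero) (simp add: field_simps)
  then have "ln (N / \<epsilon>) < real p * ln (1 / (1 - k))"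
    using large by (simp add: divide_less_eq)
  then have "ln ((1 - k) ^ p) < ln (\<epsilon> / N)"
    using k1 \<epsilon> N by (simp add: ln_div ln_realpow)
  then show ?thesis using k1 \<epsilon> N by (simp add: less_imp_le)
qed

theorem theorem5:
  fixes A :: "real ^ 'm ^ 'n"
    and \<epsilon> \<delta> b k a :: real
    and p :: nat
    and M :: "'w measure"
    and X :: "nat \<Rightarrow> 'w \<Rightarrow> real ^ 'n"
    and Z U :: "(real ^ 'n) set"
    and V :: "'w \<Rightarrow> (real ^ 'n) set"
  assumes "CARD('m) \<ge> CARD('n)"
    and "\<And>i. column i A \<noteq> 0"
    and "\<And>i j. i \<noteq> j \<Longrightarrow> \<not> (\<exists>c. column i A = c *\<^sub>R column j A)"
    and "Z = zonotope A"
    and "\<epsilon> > 0" and "\<delta> > 0"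
    and "b \<ge> diameter Z"
    and "k = ((1 / 2) * (1 - sin (arctan (b / \<delta>)))) powr ((real CARD('n) - 1) / 2)"
    and "p > 0"
    and "real p > ln (real (card (vert Z)) / \<epsilon>) / ln (1 / (1 - k))"
    and "prob_space M"
    and "prob_space.indep_vars M (\<lambda>_. borel) X {..<p}"
    and "\<And>i. i < p \<Longrightarrow> distributed M lborel (X i) (\<lambda>x. ennreal (std_gaussian_density x))"
    and "V = (\<lambda>\<omega>. vertex_enum A (\<lambda>i. X i \<omega>) p)"
    and "U = {v \<in> vert Z. simplicial_constant Z v \<ge> \<delta>}"
    and "a = real (card (vert Z - U)) / 2"
  shows "measure M {\<omega> \<in> space M. hausdorff_distance Z (convex hull (V \<omega>))
            \<le> real (card (vert Z - V \<omega>)) / 2 * \<delta>}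
          \<ge> 1 - 2 powr a * \<epsilon>"
proof -
  note cols = assms(2) and \<epsilon> = assms(5) and \<delta> = assms(6) and b = assms(7) and k = assms(8)
    and p = assms(9) and large = assms(10) and indep = assms(12) and dist = assms(13)
  interpret prob_space M by fact
  let ?P = "vert Z"
  have Z: "Z = zonotope A" by fact
  have P: "finite ?P" "centrally_symmetric ?P" "0 \<notin> ?P"
    using finite_vert_zonotope centrally_symmetric_vert_zonotope zero_notin_vert_zonotope[OF cols] by (auto simp: Z)
  have "?P \<noteq> {}"
    using convex_hull_vert_zonotope[of A] zero_in_zonotope[of A] by (auto simp: Z)
  then have N: "card ?P > 0" using P(1) by (simp add: card_gt_0_iff)
  have bounded: "bounded Z" unfolding Z by (intro compact_imp_bounded compact_zonotope)
  have k0: "0 < k" and k1: "k \<le> 1"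
  proof -
    have "b \<ge> 0" using b diameter_ge_0[OF bounded] by linarith
    then have t: "0 \<le> b / \<delta>" using \<delta> by simp
    then have s0: "0 \<le> sin (arctan (b / \<delta>))" unfolding sin_arctan by (rule divide_nonneg_nonneg) simp
    have "b / \<delta> < sqrt (1 + (b / \<delta>)\<^sup>2)" using t by (intro real_less_rsqrt) simp
    then have "sin (arctan (b / \<delta>)) < 1"
      unfolding sin_arctan using t by (subst divide_less_eq_1_pos) (auto simp: add_pos_nonneg)
    then show "0 < k" unfolding k by simp
    have "k \<le> 1 powr ((real CARD('n) - 1) / 2)"
      unfolding k using s0 \<open>sin (arctan (b / \<delta>)) < 1\<close> by (intro powr_mono2) (auto simp: Suc_le_eq)
    then show "k \<le> 1" by simp
  qed
  have X: "X i \<in> borel_measurable M" if "i < p" for i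
    using distributed_measurable[OF dist[OF that]] by simp
  \<comment> \<open>The situations in which deletion would get stuck, and which some sample has to prevent.\<close>
  define Bad where "Bad = {(S, v). S \<subseteq> ?P - U \<and> centrally_symmetric S \<and> v \<in> ?P - S \<and>
    (\<forall>y\<in>convex hull (?P - S - {v}). \<delta> \<le> norm (v - y))}"
  \<comment> \<open>Each of them is prevented by a sample in a suitable double cone.\<close>
  have "\<exists>u. norm u = 1 \<and> (\<forall>x\<in>double_cone (\<delta> / b) u.
      (\<forall>w\<in>?P - S - {v}. x \<bullet> w \<le> x \<bullet> v) \<or> (\<forall>w\<in>?P - S - {v}. x \<bullet> v \<le> x \<bullet> w)) \<and> b > 0"
    if "(S, v) \<in> Bad" for S v
  proof -
    have S: "centrally_symmetric S" "v \<in> ?P" "v \<notin> S" and far: "\<And>y. y \<in> convex hull (?P - S - {v}) \<Longrightarrow> \<delta> \<le> norm (v - y)"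
      using that by (auto simp: Bad_def)
    have "v \<noteq> - v" using S P(3) by (intro neq_uminus) auto
    then have nv: "- v \<in> ?P - S - {v}" using S P(2) by (force simp: centrally_symmetric_def)
    have nb: "norm (v - w) \<le> b" if "w \<in> ?P - S - {v}" for w
    proof -
      have "dist v w \<le> diameter Z"
        using that S vert_subset by (intro diameter_bounded_bound bounded) auto
      then show ?thesis using b by (simp add: dist_norm)
    qed
    have "b > 0" using nb[OF nv] far[OF hull_inc[OF nv]] \<delta> by linarith
    have "finite (?P - S - {v})" "?P - S - {v} \<noteq> {}" using P(1) nv by auto
    from separated_vertex_double_cone[OF this \<delta> far nb]
    obtain u where "norm u = 1" "\<And>x. x \<in> double_cone (\<delta> / b) u \<Longrightarrow>
      (\<forall>w\<in>?P - S - {v}. x \<bullet> w \<le> x \<bullet> v) \<or> (\<forall>w\<in>?P - S - {v}. x \<bullet> v \<le> x \<bullet> w)"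
      by blast
    with \<open>b > 0\<close> show ?thesis by blast
  qed
  then have "\<forall>B\<in>Bad. \<exists>u. norm u = 1 \<and> (\<forall>x\<in>double_cone (\<delta> / b) u.
      (\<forall>w\<in>?P - fst B - {snd B}. x \<bullet> w \<le> x \<bullet> snd B) \<or> (\<forall>w\<in>?P - fst B - {snd B}. x \<bullet> snd B \<le> x \<bullet> w)) \<and> b > 0"
    by (metis prod.collapse)
  then obtain u where u: "\<And>B. B \<in> Bad \<Longrightarrow> norm (u B) = 1" "\<And>B. B \<in> Bad \<Longrightarrow> b > 0"
    "\<And>B x. B \<in> Bad \<Longrightarrow> x \<in> double_cone (\<delta> / b) (u B) \<Longrightarrow>
      (\<forall>w\<in>?P - fst B - {snd B}. x \<bullet> w \<le> x \<bullet> snd B) \<or> (\<forall>w\<in>?P - fst B - {snd B}. x \<bullet> snd B \<le> x \<bullet> w)"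
    by metis
  define miss where "miss B = {\<omega>\<in>space M. \<forall>i<p. X i \<omega> \<notin> double_cone (\<delta> / b) (u B)}" for B
  have miss_sets: "miss B \<in> sets M" for B
  proof -
    have [measurable]: "double_cone (\<delta> / b) (u B) \<in> sets borel" by (intro borel_closed closed_double_cone)
    have "miss B = {\<omega>\<in>space M. \<forall>i\<in>{..<p}. X i \<omega> \<notin> double_cone (\<delta> / b) (u B)}" by (auto simp: miss_def)
    also have "\<dots> \<in> sets M"
      using X by (intro sets.sets_Collect_finite_All) (auto intro!: measurable_sets_Collect)
    finally show ?thesis .
  qed
  have miss_prob: "prob (miss B) \<le> \<epsilon> / card ?P" if B: "B \<in> Bad" for B
  proof -
    have "k = (1 / 2 * (1 - 1 / sqrt (1 + (\<delta> / b)\<^sup>2))) powr ((real CARD('n) - 1) / 2)"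
      unfolding k using sin_arctan_eq_cos_reciprocal[OF u(2)[OF B] \<delta>] by simp
    then have "prob (miss B) \<le> (1 - k) ^ p"
      using prob_gaussian_samples_miss_cone[OF indep p dist u(1)[OF B], of "\<delta> / b"] u(2)[OF B] \<delta>
      by (simp add: miss_def)
    also have "\<dots> \<le> \<epsilon> / card ?P"
      using k0 k1 \<epsilon> N p large by (intro miss_probability_small) auto
    finally show ?thesis .
  qed
  have Bad_sub: "Bad \<subseteq> {S. S \<subseteq> ?P - U \<and> centrally_symmetric S} \<times> ?P"
    by (auto simp: Bad_def)
  have fin_sym: "finite {S. S \<subseteq> ?P - U \<and> centrally_symmetric S}"
    by (rule finite_subset[of _ "Pow ?P"]) (use P(1) in auto)
  have fin_Bad: "finite Bad"
    using Bad_sub fin_sym P(1) by (meson finite_SigmaI finite_subset)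
  have "centrally_symmetric U"
    using P(2) assms(15) simplicial_constant_uminus[OF P(2)] by (auto simp: centrally_symmetric_def)
  then have "centrally_symmetric (?P - U)" by (intro centrally_symmetric_Diff P)
  then have sym_card: "real (card {S. S \<subseteq> ?P - U \<and> centrally_symmetric S}) \<le> 2 powr a"
    unfolding assms(16) using P by (intro card_symmetric_subsets) auto
  have card_Bad: "real (card Bad) \<le> 2 powr a * real (card ?P)"
  proof -
    have "card Bad \<le> card ({S. S \<subseteq> ?P - U \<and> centrally_symmetric S} \<times> ?P)"
      using Bad_sub fin_sym P(1) by (intro card_mono) auto
    then have "real (card Bad) \<le> real (card {S. S \<subseteq> ?P - U \<and> centrally_symmetric S}) * real (card ?P)"
      by (simp add: card_cartesian_product flip: of_nat_mult)
    also have "\<dots> \<le> 2 powr a * real (card ?P)"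
      using sym_card by (intro mult_right_mono) auto
    finally show ?thesis .
  qed
  let ?E = "{\<omega> \<in> space M. hausdorff_distance Z (convex hull (V \<omega>)) \<le> real (card (vert Z - V \<omega>)) / 2 * \<delta>}"
  have E_sets: "?E \<in> sets M"
    unfolding assms(14) by (rule measurable_vertex_enum[where P="\<lambda>V. hausdorff_distance Z (convex hull V) \<le> real (card (vert Z - V)) / 2 * \<delta>"]) (rule X)
  have "AE \<omega> in M. generic_direction A (X i \<omega>)" if i: "i < p" for i
  proof -
    have "AE x in density lborel (\<lambda>x. ennreal (std_gaussian_density x)). generic_direction A x"
      using AE_generic_direction[OF cols] distributed_borel_measurable[OF dist[OF i]]
      by (subst AE_density) auto
    then have "AE x in distr M lborel (X i). generic_direction A x"
      unfolding distributed_distr_eq_density[OF dist[OF i]] .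
    then show ?thesis by (rule AE_distrD[rotated]) (use X[OF i] in simp)
  qed
  then have "AE \<omega> in M. \<forall>i\<in>{..<p}. generic_direction A (X i \<omega>)"
    by (intro AE_finite_allI) auto
  then have generic: "AE \<omega> in M. \<forall>i<p. generic_direction A (X i \<omega>)"
    unfolding Ball_def lessThan_iff .
  have "AE \<omega> in M. \<omega> \<in> space M - ?E \<longrightarrow> \<omega> \<in> (\<Union>B\<in>Bad. miss B)"
  proof (rule eventually_mono[OF generic], intro impI, rule ccontr)
    fix \<omega> assume gen: "\<forall>i<p. generic_direction A (X i \<omega>)"
      and \<omega>: "\<omega> \<in> space M - ?E" and hit: "\<omega> \<notin> (\<Union>B\<in>Bad. miss B)"
    have "hausdorff_distance Z (convex hull (V \<omega>)) \<le> real (card (vert Z - V \<omega>)) / 2 * \<delta>"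
      unfolding assms(14) Z
    proof (rule enumeration_success[OF cols \<delta>])
      show "U = {v \<in> vert (zonotope A). \<delta> \<le> simplicial_constant (zonotope A) v}"
        using assms(15) by (simp add: Z)
      fix S v
      assume "S \<subseteq> vert (zonotope A) - U" "centrally_symmetric S" "v \<in> vert (zonotope A) - S"
        "\<forall>y\<in>convex hull (vert (zonotope A) - S - {v}). \<delta> \<le> norm (v - y)"
      then have B: "(S, v) \<in> Bad" by (simp add: Bad_def Z)
      then obtain i where "i < p" "X i \<omega> \<in> double_cone (\<delta> / b) (u (S, v))"
        using hit \<omega> by (auto simp: miss_def)
      then show "\<exists>i<p. (\<forall>w\<in>vert (zonotope A) - S - {v}. X i \<omega> \<bullet> w \<le> X i \<omega> \<bullet> v) \<or>
          (\<forall>w\<in>vert (zonotope A) - S - {v}. X i \<omega> \<bullet> v \<le> X i \<omega> \<bullet> w)"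
        using u(3)[OF B] by (auto simp: Z)
    qed (use gen p in auto)
    then show False using \<omega> by auto
  qed
  then have "prob (space M - ?E) \<le> prob (\<Union>B\<in>Bad. miss B)"
    using miss_sets fin_Bad by (intro finite_measure_mono_AE) auto
  also have "\<dots> \<le> (\<Sum>B\<in>Bad. prob (miss B))"
    using miss_sets fin_Bad by (intro finite_measure_subadditive_finite) auto
  also have "\<dots> \<le> real (card Bad) * (\<epsilon> / card ?P)"
    using miss_prob by (intro sum_bounded_above)
  also have "\<dots> \<le> 2 powr a * real (card ?P) * (\<epsilon> / card ?P)"
    using card_Bad \<epsilon> by (intro mult_right_mono) auto
  also have "\<dots> = 2 powr a * \<epsilon>" using N by simp
  finally show ?thesis using prob_compl[OF E_sets] by simp
qed

end
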